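(* Let $F:\mathbb{R}^{m+1}\to\mathbb{R}^{n+1}$ be a form of degree $k$ (each component of $F$ is a homogeneous polynomial of degree $k$) such that $F(\mathbb{S}^m)\subset\mathbb{S}^n$. Let $\phi:\mathbb{S}^m\to\mathbb{S}^n$ be the restriction of $F$, assumed non-constant, and let $\varphi=i\circ\phi:\mathbb{S}^m\to\mathbb{R}^{n+1}$, where $i:\mathbb{S}^n\to\mathbb{R}^{n+1}$ is the inclusion. Then, at every point of $\mathbb{S}^m$, the bitension field of $\phi$ is given by \begin{align*} \tau_2(\phi)=\;&\mathring{\Delta}\mathring{\Delta}F+2\left(mk+2k^2-3k-m+3-|\mathring{d}F|^2\right)\mathring{\Delta}F\\ &+\Big(-2\mathring{\Delta}\big(|\mathring{d}F|^2\big)-2|\mathring{\nabla}\mathring{d}F|^2+|\mathring{\Delta}F|^2\\ &\quad-2\left(2mk+6k^2-6k-m+3\right)|\mathring{d}F|^2+2|\mathring{d}F|^4+4k^2(m+2k-1)\Big)\varphi\\ &+2\,\mathring{d}F\left(\mathring{\operatorname{grad}}\big(|\mathring{d}F|^2\big)\right). \end{align*}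
   Context: $\mathbb{S}^m$ is the unit sphere in $\mathbb{R}^{m+1}$ with its round metric. The symbols $\mathring{d},\mathring{\nabla},\mathring{\Delta},\mathring{\operatorname{grad}}$ denote the differential, the flat connection, the Laplacian and the gradient on $\mathbb{R}^{m+1}$, with sign convention $\mathring{\Delta}=-\operatorname{trace}\mathring{\nabla}^2=-\sum_j\partial_j^2$ (applied componentwise to vector-valued functions); all these terms are computed on $\mathbb{R}^{m+1}$ and then restricted to $\mathbb{S}^m$. $|\mathring{d}F|$ and $|\mathring{\nabla}\mathring{d}F|$ are Hilbert–Schmidt norms. Tangent vectors to $\mathbb{S}^n$ are identified with vectors of $\mathbb{R}^{n+1}$, so $\tau_2(\phi)$ is viewed as an $\mathbb{R}^{n+1}$-valued function on $\mathbb{S}^m$. For a smooth map $\phi:(M,g)\to(N,h)$ between Riemannian manifolds, the tension field is $\tau(\phi)=\operatorname{trace}\nabla d\phi$ and the bitension field is $\tau_2(\phi)=-\Delta\tau(\phi)-\operatorname{trace}R^N(d\phi(\cdot),\tau(\phi))d\phi(\cdot)$, where $\Delta\sigma=-\operatorname{trace}_g\nabla^2\sigma$ is the rough Laplacian on sections of $\phi^{-1}TN$ and $R(X,Y)Z=\nabla_X\nabla_YZ-\nabla_Y\nabla_XZ-\nabla_{[X,Y]}Z$. *)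

theory Defs
  imports "HOL-Analysis.Analysis"
begin

definition partial :: "'a::euclidean_space \<Rightarrow> ('a \<Rightarrow> 'b::real_normed_vector) \<Rightarrow> 'a \<Rightarrow> 'b" where
  "partial b f x = frechet_derivative f (at x) b"

definition flat_laplacian :: "('a::euclidean_space \<Rightarrow> 'b::real_normed_vector) \<Rightarrow> 'a \<Rightarrow> 'b" where
  "flat_laplacian f x = - (\<Sum>b\<in>Basis. partial b (partial b f) x)"

definition flat_grad :: "('a::euclidean_space \<Rightarrow> real) \<Rightarrow> 'a \<Rightarrow> 'a" where
  "flat_grad h x = (\<Sum>b\<in>Basis. partial b h x *\<^sub>R b)"

definition norm_d :: "('a::euclidean_space \<Rightarrow> 'b::real_normed_vector) \<Rightarrow> 'a \<Rightarrow> real" where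
  "norm_d f x = sqrt (\<Sum>b\<in>Basis. (norm (partial b f x))\<^sup>2)"

definition norm_dd :: "('a::euclidean_space \<Rightarrow> 'b::real_normed_vector) \<Rightarrow> 'a \<Rightarrow> real" where
  "norm_dd f x = sqrt (\<Sum>b\<in>Basis. \<Sum>c\<in>Basis. (norm (partial b (partial c f) x))\<^sup>2)"

definition form :: "nat \<Rightarrow> (real^'p \<Rightarrow> real^'q) \<Rightarrow> bool" where
  "form k F \<longleftrightarrow>
     (\<exists>c :: 'q \<Rightarrow> ('p \<Rightarrow> nat) \<Rightarrow> real. \<forall>x j.
        F x $ j = (\<Sum>\<alpha> | (\<Sum>i\<in>UNIV. \<alpha> i) = k. c j \<alpha> * (\<Prod>i\<in>UNIV. x $ i ^ \<alpha> i)))"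

abbreviation unit_sphere :: "'a::euclidean_space set" where
  "unit_sphere \<equiv> sphere 0 1"

primrec Ck_on :: "nat \<Rightarrow> ('a::euclidean_space \<Rightarrow> 'b::real_normed_vector) \<Rightarrow> 'a set \<Rightarrow> bool" where
  "Ck_on 0 f U \<longleftrightarrow> continuous_on U f"
| "Ck_on (Suc j) f U \<longleftrightarrow>
     f differentiable_on U \<and> (\<forall>v. Ck_on j (\<lambda>x. frechet_derivative f (at x) v) U)"

text \<open>Only the values on the sphere matter in all notions below; a map is smooth on the sphere iff
  it extends smoothly to a neighbourhood of each of its points.\<close>

definition smooth_on_sphere :: "('a::euclidean_space \<Rightarrow> 'b::real_normed_vector) \<Rightarrow> bool" where
  "smooth_on_sphere f \<longleftrightarrow>
     (\<forall>x\<in>unit_sphere. \<exists>U g. open U \<and> x \<in> U \<and> (\<forall>j. Ck_on j g U) \<and>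
        (\<forall>y\<in>U \<inter> unit_sphere. g y = f y))"

text \<open>Tangent vectors of the sphere are identified with vectors of the ambient space.\<close>

definition tangent_space :: "'a::euclidean_space \<Rightarrow> 'a set" where
  "tangent_space x = {v. x \<bullet> v = 0}"

text \<open>The derivative of \<open>f\<close> within the sphere is determined by \<open>f\<close> on tangent vectors only;
  it is never applied to other vectors below.\<close>

definition sphere_d :: "('a::euclidean_space \<Rightarrow> 'b::real_normed_vector) \<Rightarrow> 'a \<Rightarrow> 'a \<Rightarrow> 'b" where
  "sphere_d f x v = frechet_derivative f (at x within unit_sphere) v"

text \<open>Smooth sections of the pull-back of the tangent bundle of the target sphere along \<open>f\<close>;
  for \<open>f = id\<close> these are the vector fields on the sphere.\<close>

definition section_along :: "('a::euclidean_space \<Rightarrow> 'b::euclidean_space) \<Rightarrow> ('a \<Rightarrow> 'b) \<Rightarrow> bool" where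
  "section_along f \<sigma> \<longleftrightarrow>
     smooth_on_sphere \<sigma> \<and> (\<forall>x\<in>unit_sphere. \<sigma> x \<in> tangent_space (f x))"

abbreviation vector_field :: "('a::euclidean_space \<Rightarrow> 'a) \<Rightarrow> bool" where
  "vector_field X \<equiv> section_along id X"

text \<open>Computed componentwise in the ambient space: the derivation
  \<open>h \<mapsto> X(Yh) - Y(Xh)\<close> applied to the coordinate functions.\<close>

definition lie_bracket :: "('a::euclidean_space \<Rightarrow> 'a) \<Rightarrow> ('a \<Rightarrow> 'a) \<Rightarrow> 'a \<Rightarrow> 'a" where
  "lie_bracket X Y x = sphere_d Y x (X x) - sphere_d X x (Y x)"

text \<open>In \<open>D \<sigma> x v\<close>, a section \<open>\<sigma>\<close> is differentiated at the point \<open>x\<close> in the direction of the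
  tangent vector \<open>v\<close>.\<close>

definition connection_along ::
  "('a::euclidean_space \<Rightarrow> 'b::euclidean_space) \<Rightarrow> (('a \<Rightarrow> 'b) \<Rightarrow> 'a \<Rightarrow> 'a \<Rightarrow> 'b) \<Rightarrow> bool" where
  "connection_along f D \<longleftrightarrow>
     (\<forall>\<sigma> X. section_along f \<sigma> \<longrightarrow> vector_field X \<longrightarrow> section_along f (\<lambda>x. D \<sigma> x (X x))) \<and>
     (\<forall>\<sigma>. section_along f \<sigma> \<longrightarrow>
        (\<forall>x\<in>unit_sphere. \<forall>v\<in>tangent_space x. \<forall>w\<in>tangent_space x. \<forall>a b.
           D \<sigma> x (a *\<^sub>R v + b *\<^sub>R w) = a *\<^sub>R D \<sigma> x v + b *\<^sub>R D \<sigma> x w)) \<and>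
     (\<forall>\<sigma> \<rho>. section_along f \<sigma> \<longrightarrow> section_along f \<rho> \<longrightarrow>
        (\<forall>x\<in>unit_sphere. \<forall>v\<in>tangent_space x. D (\<lambda>y. \<sigma> y + \<rho> y) x v = D \<sigma> x v + D \<rho> x v)) \<and>
     (\<forall>h :: 'a \<Rightarrow> real. \<forall>\<sigma>. smooth_on_sphere h \<longrightarrow> section_along f \<sigma> \<longrightarrow>
        (\<forall>x\<in>unit_sphere. \<forall>v\<in>tangent_space x.
           D (\<lambda>y. h y *\<^sub>R \<sigma> y) x v = sphere_d h x v *\<^sub>R \<sigma> x + h x *\<^sub>R D \<sigma> x v))"

text \<open>The round metric is the restriction of the ambient inner product.\<close>

definition is_levi_civita :: "(('a::euclidean_space \<Rightarrow> 'a) \<Rightarrow> 'a \<Rightarrow> 'a \<Rightarrow> 'a) \<Rightarrow> bool" where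
  "is_levi_civita D \<longleftrightarrow>
     connection_along id D \<and>
     (\<forall>X Y. vector_field X \<longrightarrow> vector_field Y \<longrightarrow>
        (\<forall>x\<in>unit_sphere. D Y x (X x) - D X x (Y x) = lie_bracket X Y x)) \<and>
     (\<forall>X Y. vector_field X \<longrightarrow> vector_field Y \<longrightarrow>
        (\<forall>x\<in>unit_sphere. \<forall>v\<in>tangent_space x.
           sphere_d (\<lambda>y. X y \<bullet> Y y) x v = D X x v \<bullet> Y x + X x \<bullet> D Y x v))"

definition levi_civita :: "('a::euclidean_space \<Rightarrow> 'a) \<Rightarrow> 'a \<Rightarrow> 'a \<Rightarrow> 'a" where
  "levi_civita = (SOME D. is_levi_civita D)"

definition is_pullback_connection ::
  "('a::euclidean_space \<Rightarrow> 'b::euclidean_space) \<Rightarrow> (('a \<Rightarrow> 'b) \<Rightarrow> 'a \<Rightarrow> 'a \<Rightarrow> 'b) \<Rightarrow> bool" where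
  "is_pullback_connection f D \<longleftrightarrow>
     connection_along f D \<and>
     (\<forall>Z. vector_field Z \<longrightarrow>
        (\<forall>x\<in>unit_sphere. \<forall>v\<in>tangent_space x.
           D (\<lambda>y. Z (f y)) x v = levi_civita Z (f x) (sphere_d f x v)))"

definition pullback_connection ::
  "('a::euclidean_space \<Rightarrow> 'b::euclidean_space) \<Rightarrow> ('a \<Rightarrow> 'b) \<Rightarrow> 'a \<Rightarrow> 'a \<Rightarrow> 'b" where
  "pullback_connection f = (SOME D. is_pullback_connection f D)"

text \<open>A vector field with value \<open>w\<close> at every point to which \<open>w\<close> is tangent. It is used to evaluate
  tensors on tangent vectors; the values do not depend on the choice of such an extension.\<close>

definition extend :: "'a::euclidean_space \<Rightarrow> 'a \<Rightarrow> 'a" where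
  "extend w y = w - (y \<bullet> w) *\<^sub>R y"

definition onb_tangent :: "'a::euclidean_space \<Rightarrow> 'a set \<Rightarrow> bool" where
  "onb_tangent x B \<longleftrightarrow>
     pairwise orthogonal B \<and> (\<forall>e\<in>B. norm e = 1) \<and> span B = tangent_space x"

definition metric_trace :: "'a::euclidean_space \<Rightarrow> ('a \<Rightarrow> 'a \<Rightarrow> 'b::real_vector) \<Rightarrow> 'b" where
  "metric_trace x \<beta> = (\<Sum>e\<in>(SOME B. onb_tangent x B). \<beta> e e)"

definition second_fundamental_form ::
  "('a::euclidean_space \<Rightarrow> 'b::euclidean_space) \<Rightarrow> 'a \<Rightarrow> 'a \<Rightarrow> 'a \<Rightarrow> 'b" where
  "second_fundamental_form f x v w =
     pullback_connection f (\<lambda>y. sphere_d f y (extend w y)) x v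
     - sphere_d f x (levi_civita (extend w) x v)"

definition tension_field :: "('a::euclidean_space \<Rightarrow> 'b::euclidean_space) \<Rightarrow> 'a \<Rightarrow> 'b" where
  "tension_field f x = metric_trace x (second_fundamental_form f x)"

definition second_covariant_derivative ::
  "('a::euclidean_space \<Rightarrow> 'b::euclidean_space) \<Rightarrow> ('a \<Rightarrow> 'b) \<Rightarrow> 'a \<Rightarrow> 'a \<Rightarrow> 'a \<Rightarrow> 'b" where
  "second_covariant_derivative f \<sigma> x v w =
     pullback_connection f (\<lambda>y. pullback_connection f \<sigma> y (extend w y)) x v
     - pullback_connection f \<sigma> x (levi_civita (extend w) x v)"

definition rough_laplacian ::
  "('a::euclidean_space \<Rightarrow> 'b::euclidean_space) \<Rightarrow> ('a \<Rightarrow> 'b) \<Rightarrow> 'a \<Rightarrow> 'b" where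
  "rough_laplacian f \<sigma> x = - metric_trace x (second_covariant_derivative f \<sigma> x)"

definition curvature :: "'a::euclidean_space \<Rightarrow> 'a \<Rightarrow> 'a \<Rightarrow> 'a \<Rightarrow> 'a" where
  "curvature y u v w =
     levi_civita (\<lambda>z. levi_civita (extend w) z (extend v z)) y u
     - levi_civita (\<lambda>z. levi_civita (extend w) z (extend u z)) y v
     - levi_civita (extend w) y (lie_bracket (extend u) (extend v) y)"

definition bitension_field :: "('a::euclidean_space \<Rightarrow> 'b::euclidean_space) \<Rightarrow> 'a \<Rightarrow> 'b" where
  "bitension_field f x =
     - rough_laplacian f (tension_field f) x
     - metric_trace x (\<lambda>v w. curvature (f x) (sphere_d f x v) (tension_field f x) (sphere_d f x w))"

lemma Ck_on_Suc_D: "Ck_on (Suc j) f U \<Longrightarrow> Ck_on j f U"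
proof (induction j arbitrary: f)
  case 0 then show ?case by (auto intro: differentiable_imp_continuous_on)
next
  case (Suc j)
  from Suc.prems have 1: "f differentiable_on U"
    and 2: "\<And>v. Ck_on (Suc j) (\<lambda>x. frechet_derivative f (at x) v) U" using Ck_on.simps(2) by blast+
  show ?case unfolding Ck_on.simps(2)[of j] using 1 Suc.IH[OF 2] by blast
qed

lemma Ck_on_mono: "Ck_on j f U \<Longrightarrow> V \<subseteq> U \<Longrightarrow> Ck_on j f V"
  by (induction j arbitrary: f) (auto intro: continuous_on_subset differentiable_on_subset)

lemma Ck_on_cong:
  assumes "open U" "\<And>x. x \<in> U \<Longrightarrow> f x = g x" "Ck_on j f U"
  shows "Ck_on j g U"
  using assms(2,3)
proof (induction j arbitrary: f g)
  case 0 then show ?case using continuous_on_cong by force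
next
  case (Suc j)
  have hd: "(g has_derivative frechet_derivative f (at x)) (at x)" if "x \<in> U" for x
  proof -
    have "f differentiable (at x)" using Suc.prems(2) that assms(1) by (simp add: differentiable_on_eq_differentiable_at)
    hence "(f has_derivative frechet_derivative f (at x)) (at x)" using frechet_derivative_works by blast
    thus ?thesis using has_derivative_transform_within_open[OF _ assms(1) that] Suc.prems(1) by blast
  qed
  have eq: "frechet_derivative f (at x) v = frechet_derivative g (at x) v" if "x \<in> U" for x v
    using frechet_derivative_at[OF hd[OF that]] by simp
  have "g differentiable_on U" using hd assms(1)
    by (auto simp: differentiable_on_eq_differentiable_at differentiable_def)
  moreover have "Ck_on j (\<lambda>x. frechet_derivative g (at x) v) U" for v
  proof (rule Suc.IH)
    show "Ck_on j (\<lambda>x. frechet_derivative f (at x) v) U" using Suc.prems(2) by simp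
  qed (rule eq)
  ultimately show ?case by simp
qed

lemma Ck_on_imp_diff: "Ck_on (Suc j) f U \<Longrightarrow> open U \<Longrightarrow> x \<in> U \<Longrightarrow> (f has_derivative frechet_derivative f (at x)) (at x)"
  by (simp add: differentiable_on_eq_differentiable_at frechet_derivative_works[symmetric])

lemma Ck_on_SucI:
  assumes "open U" "\<And>x. x \<in> U \<Longrightarrow> (f has_derivative f' x) (at x)" "\<And>v. Ck_on j (\<lambda>x. f' x v) U"
  shows "Ck_on (Suc j) f U"
proof -
  have "f' x v = frechet_derivative f (at x) v" if "x \<in> U" for x v
    using frechet_derivative_at[OF assms(2)[OF that]] by simp
  from Ck_on_cong[OF assms(1) this assms(3)]
  have "Ck_on j (\<lambda>x. frechet_derivative f (at x) v) U" for v by simp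
  moreover have "f differentiable_on U"
    using assms(1,2) by (auto simp: differentiable_on_eq_differentiable_at differentiable_def)
  ultimately show ?thesis by simp
qed

lemma Ck_on_const: "open U \<Longrightarrow> Ck_on j (\<lambda>x. c) U"
proof (induction j arbitrary: c)
  case (Suc j)
  show ?case by (rule Ck_on_SucI[OF \<open>open U\<close> has_derivative_const]) (use Suc in simp)
qed simp

lemma Ck_on_id: "open U \<Longrightarrow> Ck_on j (\<lambda>x. x) U"
proof (cases j)
  case (Suc j)
  assume "open U"
  show ?thesis unfolding Suc by (rule Ck_on_SucI[OF \<open>open U\<close> has_derivative_ident]) (simp add: Ck_on_const \<open>open U\<close>)
qed simp

lemma Ck_on_add: "open U \<Longrightarrow> Ck_on j f U \<Longrightarrow> Ck_on j g U \<Longrightarrow> Ck_on j (\<lambda>x. f x + g x) U"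
proof (induction j arbitrary: f g)
  case (Suc j)
  show ?case
    by (rule Ck_on_SucI[OF Suc(2)])
       (rule has_derivative_add Ck_on_imp_diff[OF Suc(3,2)] Ck_on_imp_diff[OF Suc(4,2)] | assumption | use Suc in simp)+
qed (simp add: continuous_on_add)

lemma Ck_on_bilinear:
  assumes B: "bounded_bilinear B" and U: "open U"
  shows "Ck_on j f U \<Longrightarrow> Ck_on j g U \<Longrightarrow> Ck_on j (\<lambda>x. B (f x) (g x)) U"
proof (induction j arbitrary: f g)
  case 0 then show ?case using bounded_bilinear.continuous_on[OF B] by simp
next
  case (Suc j)
  have fg: "Ck_on j f U" "Ck_on j g U" using Suc.prems Ck_on_Suc_D by blast+
  show ?case
  proof (rule Ck_on_SucI[OF U])
    fix x assume x: "x \<in> U"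
    show "((\<lambda>x. B (f x) (g x)) has_derivative
       (\<lambda>v. B (f x) (frechet_derivative g (at x) v) + B (frechet_derivative f (at x) v) (g x))) (at x)"
      by (rule bounded_bilinear.FDERIV[OF B Ck_on_imp_diff[OF Suc.prems(1) U x] Ck_on_imp_diff[OF Suc.prems(2) U x]])
  next
    fix v
    show "Ck_on j (\<lambda>x. B (f x) (frechet_derivative g (at x) v) + B (frechet_derivative f (at x) v) (g x)) U"
      by (rule Ck_on_add[OF U]; rule Suc.IH; use Suc.prems fg in simp)
  qed
qed

lemma Ck_on_sum: "open U \<Longrightarrow> (\<And>i. i \<in> I \<Longrightarrow> Ck_on j (f i) U) \<Longrightarrow> Ck_on j (\<lambda>x. \<Sum>i\<in>I. f i x) U"
  by (induction I rule: infinite_finite_induct) (simp_all add: Ck_on_const Ck_on_add)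

lemma smooth_on_sphereD:
  assumes "smooth_on_sphere f" "x \<in> unit_sphere"
  shows "\<exists>U g. open U \<and> x \<in> U \<and> (\<forall>j. Ck_on j g U) \<and> (\<forall>y\<in>U \<inter> unit_sphere. g y = f y)"
  using assms unfolding smooth_on_sphere_def by (rule bspec)

lemma smooth_witness:
  assumes "open U" "x \<in> U" "\<And>j. Ck_on j g U" "\<And>y. y \<in> U \<inter> unit_sphere \<Longrightarrow> g y = f y"
  shows "\<exists>U g. open U \<and> x \<in> U \<and> (\<forall>j. Ck_on j g U) \<and> (\<forall>y\<in>U \<inter> unit_sphere. g y = f y)"
  by (rule exI[of _ U], rule exI[of _ g]) (simp add: assms)

lemma smooth_on_sphere_UNIV: "(\<And>j. Ck_on j f UNIV) \<Longrightarrow> smooth_on_sphere f"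
  unfolding smooth_on_sphere_def by (intro ballI smooth_witness[of UNIV _ f]) simp_all

lemma smooth_const: "smooth_on_sphere (\<lambda>x. c)"
  by (rule smooth_on_sphere_UNIV[OF Ck_on_const[OF open_UNIV]])

lemma smooth_id: "smooth_on_sphere (\<lambda>x. x)"
  by (rule smooth_on_sphere_UNIV[OF Ck_on_id[OF open_UNIV]])

lemma smooth_bilinear:
  fixes f :: "'a::euclidean_space \<Rightarrow> 'b::real_normed_vector"
  assumes B: "bounded_bilinear B" and f: "smooth_on_sphere f" and g: "smooth_on_sphere g"
  shows "smooth_on_sphere (\<lambda>x. B (f x) (g x))"
  unfolding smooth_on_sphere_def
proof
  fix x :: 'a assume x: "x \<in> unit_sphere"
  obtain U f' where 1: "open U" "x \<in> U" "\<forall>j. Ck_on j f' U" "\<forall>y\<in>U \<inter> unit_sphere. f' y = f y"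
    using smooth_on_sphereD[OF f x] by (elim exE conjE)
  obtain V g' where 2: "open V" "x \<in> V" "\<forall>j. Ck_on j g' V" "\<forall>y\<in>V \<inter> unit_sphere. g' y = g y"
    using smooth_on_sphereD[OF g x] by (elim exE conjE)
  have open_UV: "open (U \<inter> V)" and x_UV: "x \<in> U \<inter> V" using 1(1,2) 2(1,2) by (simp_all add: open_Int)
  have eq: "B (f' y) (g' y) = B (f y) (g y)" if "y \<in> U \<inter> V \<inter> unit_sphere" for y
    using that 1(4) 2(4) by simp
  have Ck: "Ck_on j (\<lambda>x. B (f' x) (g' x)) (U \<inter> V)" for j
    by (rule Ck_on_bilinear[OF B open_Int[OF 1(1) 2(1)] Ck_on_mono[OF spec[OF 1(3)]] Ck_on_mono[OF spec[OF 2(3)]]]) auto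
  show "\<exists>U h. open U \<and> x \<in> U \<and> (\<forall>j. Ck_on j h U) \<and> (\<forall>y\<in>U \<inter> unit_sphere. h y = B (f y) (g y))"
    by (rule smooth_witness[OF open_UV x_UV Ck]) (rule eq)
qed

lemma smooth_add:
  fixes f :: "'a::euclidean_space \<Rightarrow> 'b::real_normed_vector"
  assumes f: "smooth_on_sphere f" and g: "smooth_on_sphere g"
  shows "smooth_on_sphere (\<lambda>x. f x + g x)"
  unfolding smooth_on_sphere_def
proof
  fix x :: 'a assume x: "x \<in> unit_sphere"
  obtain U f' where 1: "open U" "x \<in> U" "\<forall>j. Ck_on j f' U" "\<forall>y\<in>U \<inter> unit_sphere. f' y = f y"
    using smooth_on_sphereD[OF f x] by (elim exE conjE)
  obtain V g' where 2: "open V" "x \<in> V" "\<forall>j. Ck_on j g' V" "\<forall>y\<in>V \<inter> unit_sphere. g' y = g y"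
    using smooth_on_sphereD[OF g x] by (elim exE conjE)
  have open_UV: "open (U \<inter> V)" and x_UV: "x \<in> U \<inter> V" using 1(1,2) 2(1,2) by (simp_all add: open_Int)
  have eq: "f' y + g' y = f y + g y" if "y \<in> U \<inter> V \<inter> unit_sphere" for y
    using that 1(4) 2(4) by simp
  have Ck: "Ck_on j (\<lambda>x. f' x + g' x) (U \<inter> V)" for j
    by (rule Ck_on_add[OF open_Int[OF 1(1) 2(1)] Ck_on_mono[OF spec[OF 1(3)]] Ck_on_mono[OF spec[OF 2(3)]]]) auto
  show "\<exists>U h. open U \<and> x \<in> U \<and> (\<forall>j. Ck_on j h U) \<and> (\<forall>y\<in>U \<inter> unit_sphere. h y = f y + g y)"
    by (rule smooth_witness[OF open_UV x_UV Ck]) (rule eq)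
qed

lemma sphere_d_unique:
  fixes f :: "'a::euclidean_space \<Rightarrow> 'b::real_normed_vector"
  assumes L: "(f has_derivative L) (at x within unit_sphere)"
    and L': "(f has_derivative L') (at x within unit_sphere)"
    and x: "x \<in> unit_sphere" and v: "v \<in> tangent_space x"
  shows "L v = L' v"
proof -
  define c where "c t = inverse (sqrt (1 + t\<^sup>2 * (v \<bullet> v))) *\<^sub>R (x + t *\<^sub>R v)" for t :: real
  have pos: "1 + t\<^sup>2 * (v \<bullet> v) > 0" for t :: real by (simp add: add_pos_nonneg)
  have xx: "x \<bullet> x = 1" using x by (simp add: norm_eq_1)
  have xv: "x \<bullet> v = 0" "v \<bullet> x = 0" using v by (simp_all add: tangent_space_def inner_commute)
  have nn: "norm (x + t *\<^sub>R v) = sqrt (1 + t\<^sup>2 * (v \<bullet> v))" for t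
    unfolding norm_eq_sqrt_inner by (simp add: inner_add inner_commute xx xv power2_eq_square)
  have S: "c t \<in> unit_sphere" for t
    using pos[of t] by (simp add: c_def nn)
  have c0: "c 0 = x" by (simp add: c_def)
  have "((\<lambda>t. inverse (sqrt (1 + t\<^sup>2 * (v \<bullet> v)))) has_real_derivative 0) (at 0)"
    by (auto intro!: derivative_eq_intros)
  moreover have "((\<lambda>t. x + t *\<^sub>R v) has_vector_derivative v) (at 0)"
    by (auto intro!: derivative_eq_intros)
  ultimately have d: "(c has_vector_derivative v) (at 0)"
    unfolding c_def[abs_def] using has_vector_derivative_scaleR by fastforce
  have c_range: "range c \<subseteq> unit_sphere" using S by blast
  have d': "(c has_derivative (\<lambda>h. h *\<^sub>R v)) (at 0)"
    using d by (simp add: has_vector_derivative_def)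
  have "(f has_derivative L) (at (c 0) within range c)"
    unfolding c0 using L c_range by (rule has_derivative_subset)
  from diff_chain_within[OF d' this]
  have "((f \<circ> c) has_derivative L \<circ> (\<lambda>h. h *\<^sub>R v)) (at 0)" .
  moreover have "(f has_derivative L') (at (c 0) within range c)"
    unfolding c0 using L' c_range by (rule has_derivative_subset)
  from diff_chain_within[OF d' this]
  have "((f \<circ> c) has_derivative L' \<circ> (\<lambda>h. h *\<^sub>R v)) (at 0)" .
  ultimately have "L \<circ> (\<lambda>h. h *\<^sub>R v) = L' \<circ> (\<lambda>h. h *\<^sub>R v)"
    by (rule has_derivative_unique)
  from fun_cong[OF this, of 1] show ?thesis by simp
qed

lemma sphere_d_eqI:
  fixes f :: "'a::euclidean_space \<Rightarrow> 'b::real_normed_vector"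
  assumes L: "(f has_derivative L) (at x within unit_sphere)"
    and x: "x \<in> unit_sphere" and v: "v \<in> tangent_space x"
  shows "sphere_d f x v = L v"
proof -
  have "(f has_derivative frechet_derivative f (at x within unit_sphere)) (at x within unit_sphere)"
    using L frechet_derivative_works differentiable_def by blast
  from sphere_d_unique[OF this L x v] show ?thesis by (simp add: sphere_d_def)
qed

lemma smooth_ext_deriv:
  assumes "open U" "y \<in> U" "y \<in> unit_sphere" "\<forall>j. Ck_on j g U" "\<forall>y\<in>U \<inter> unit_sphere. g y = f y"
  shows "(f has_derivative frechet_derivative g (at y)) (at y within unit_sphere)"
proof -
  have "(g has_derivative frechet_derivative g (at y)) (at y within unit_sphere)"
    using Ck_on_imp_diff[OF spec[OF assms(4)] assms(1,2)] has_derivative_at_withinI by blast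
  moreover have "\<forall>\<^sub>F z in at y within unit_sphere. g z = f z"
    unfolding eventually_at_topological by (rule exI[of _ U]) (simp add: assms)
  moreover have "g y = f y" using assms(2,3,5) by simp
  ultimately show ?thesis using assms(3) by (rule has_derivative_transform_eventually)
qed

lemma smooth_has_derivative:
  assumes "smooth_on_sphere f" "x \<in> unit_sphere"
  shows "(f has_derivative sphere_d f x) (at x within unit_sphere)"
proof -
  obtain U g where 1: "open U" "x \<in> U" "\<forall>j. Ck_on j g U" "\<forall>y\<in>U \<inter> unit_sphere. g y = f y"
    using smooth_on_sphereD[OF assms] by (elim exE conjE)
  from smooth_ext_deriv[OF 1(1,2) assms(2) 1(3,4)]
  have "f differentiable (at x within unit_sphere)" by (rule differentiableI)
  then show ?thesis
    unfolding sphere_d_def[abs_def] by (rule iffD1[OF frechet_derivative_works])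
qed

lemma smooth_sphere_d:
  fixes f :: "'a::euclidean_space \<Rightarrow> 'b::real_normed_vector"
  assumes f: "smooth_on_sphere f" and X: "vector_field X"
  shows "smooth_on_sphere (\<lambda>x. sphere_d f x (X x))"
  unfolding smooth_on_sphere_def
proof
  fix x :: 'a assume x: "x \<in> unit_sphere"
  obtain U g where 1: "open U" "x \<in> U" "\<forall>j. Ck_on j g U" "\<forall>y\<in>U \<inter> unit_sphere. g y = f y"
    using smooth_on_sphereD[OF f x] by (elim exE conjE)
  have sX: "smooth_on_sphere X" using X by (simp add: section_along_def)
  obtain V Y where 2: "open V" "x \<in> V" "\<forall>j. Ck_on j Y V" "\<forall>y\<in>V \<inter> unit_sphere. Y y = X y"
    using smooth_on_sphereD[OF sX x] by (elim exE conjE)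
  let ?h = "\<lambda>y. \<Sum>b\<in>Basis. (Y y \<bullet> b) *\<^sub>R frechet_derivative g (at y) b"
  have o: "open (U \<inter> V)" and x_UV: "x \<in> U \<inter> V" using 1(1,2) 2(1,2) by (simp_all add: open_Int)
  have Ck: "Ck_on j ?h (U \<inter> V)" for j
  proof (intro Ck_on_sum[OF o] Ck_on_bilinear[OF bounded_bilinear_scaleR o])
    fix b :: 'a
    show "Ck_on j (\<lambda>x. Y x \<bullet> b) (U \<inter> V)"
      by (rule Ck_on_bilinear[OF bounded_bilinear_inner o Ck_on_mono[OF spec[OF 2(3)]] Ck_on_const[OF o]]) simp
    have "Ck_on (Suc j) g U" by (rule spec[OF 1(3)])
    then have "Ck_on j (\<lambda>x. frechet_derivative g (at x) b) U" by simp
    then show "Ck_on j (\<lambda>x. frechet_derivative g (at x) b) (U \<inter> V)"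
      by (rule Ck_on_mono) simp
  qed
  have h: "?h y = sphere_d f y (X y)" if y: "y \<in> U \<inter> V" "y \<in> unit_sphere" for y
  proof -
    have t: "X y \<in> tangent_space y" using X y by (simp add: section_along_def)
    have l: "linear (frechet_derivative g (at y))"
      using Ck_on_imp_diff[OF spec[OF 1(3)] 1(1)] y has_derivative_linear by blast
    have "sphere_d f y (X y) = frechet_derivative g (at y) (X y)"
      by (rule sphere_d_eqI[OF smooth_ext_deriv[OF 1(1) _ y(2) 1(3,4)] y(2) t]) (use y in auto)
    also have "\<dots> = frechet_derivative g (at y) (\<Sum>b\<in>Basis. (X y \<bullet> b) *\<^sub>R b)"
      by (simp add: euclidean_representation)
    also have "\<dots> = ?h y" using y 2(4) by (simp add: linear_sum[OF l] linear_scale[OF l])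
    finally show ?thesis by simp
  qed
  show "\<exists>U h. open U \<and> x \<in> U \<and> (\<forall>j. Ck_on j h U) \<and> (\<forall>y\<in>U \<inter> unit_sphere. h y = sphere_d f y (X y))"
    by (rule smooth_witness[OF o x_UV Ck]) (use h in blast)
qed

text \<open>The tangential part of the ambient derivative. It witnesses that the connections chosen above
  exist; for \<open>levi_civita\<close>, uniqueness on vector fields and tangent vectors is shown as well.\<close>

definition tproj :: "('a::euclidean_space \<Rightarrow> 'b::euclidean_space) \<Rightarrow> ('a \<Rightarrow> 'b) \<Rightarrow> 'a \<Rightarrow> 'a \<Rightarrow> 'b" where
  "tproj f \<sigma> x v = extend (sphere_d \<sigma> x v) (f x)"

lemma extend_add: "extend (v + w) y = extend v y + extend w y"
  and extend_diff: "extend (v - w) y = extend v y - extend w y"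
  and extend_scaleR: "extend (a *\<^sub>R v) y = a *\<^sub>R extend v y"
  by (simp_all add: extend_def algebra_simps inner_add_right inner_diff_right)

lemma extend_tangent: "w \<in> tangent_space y \<Longrightarrow> extend w y = w"
  by (simp add: extend_def tangent_space_def)

lemma extend_in_tangent: "y \<in> unit_sphere \<Longrightarrow> extend w y \<in> tangent_space y"
  by (simp add: extend_def tangent_space_def inner_diff_right norm_eq_1)

lemma connection_tproj:
  fixes f :: "'a::euclidean_space \<Rightarrow> 'b::euclidean_space"
  assumes f: "smooth_on_sphere f" and fS: "f ` unit_sphere \<subseteq> unit_sphere"
  shows "connection_along f (tproj f)"
  unfolding connection_along_def
proof (intro conjI allI impI ballI)
  fix \<sigma> :: "'a \<Rightarrow> 'b" and X :: "'a \<Rightarrow> 'a" assume s: "section_along f \<sigma>" and X: "vector_field X"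
  have "smooth_on_sphere (\<lambda>x. sphere_d \<sigma> x (X x))"
    using s X smooth_sphere_d by (auto simp: section_along_def)
  note sd = this
  have "smooth_on_sphere (\<lambda>x. sphere_d \<sigma> x (X x) + (-1) *\<^sub>R ((f x \<bullet> sphere_d \<sigma> x (X x)) *\<^sub>R f x))"
    by (intro smooth_add smooth_bilinear[OF bounded_bilinear_scaleR] smooth_bilinear[OF bounded_bilinear_inner]
        smooth_const f sd)
  then show "section_along f (\<lambda>x. tproj f \<sigma> x (X x))"
    using fS extend_in_tangent by (fastforce simp: section_along_def tproj_def extend_def)
next
  fix \<sigma> :: "'a \<Rightarrow> 'b" and x v w :: 'a and a b :: real
  assume s: "section_along f \<sigma>" and x: "x \<in> unit_sphere"
  have "smooth_on_sphere \<sigma>" using s by (simp add: section_along_def)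
  from has_derivative_linear[OF smooth_has_derivative[OF this x]] have "linear (sphere_d \<sigma> x)" .
  then show "tproj f \<sigma> x (a *\<^sub>R v + b *\<^sub>R w) = a *\<^sub>R tproj f \<sigma> x v + b *\<^sub>R tproj f \<sigma> x w"
    by (simp add: tproj_def linear_add linear_scale extend_add extend_scaleR)
next
  fix \<sigma> \<rho> :: "'a \<Rightarrow> 'b" and x v :: 'a
  assume s: "section_along f \<sigma>" and r: "section_along f \<rho>" and x: "x \<in> unit_sphere" and v: "v \<in> tangent_space x"
  have "sphere_d (\<lambda>y. \<sigma> y + \<rho> y) x v = sphere_d \<sigma> x v + sphere_d \<rho> x v"
    by (rule sphere_d_eqI[OF has_derivative_add[OF smooth_has_derivative smooth_has_derivative] x v])
       (use s r x in \<open>simp_all add: section_along_def\<close>)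
  then show "tproj f (\<lambda>y. \<sigma> y + \<rho> y) x v = tproj f \<sigma> x v + tproj f \<rho> x v"
    by (simp add: tproj_def extend_add)
next
  fix h :: "'a \<Rightarrow> real" and \<sigma> :: "'a \<Rightarrow> 'b" and x v :: 'a
  assume h: "smooth_on_sphere h" and s: "section_along f \<sigma>" and x: "x \<in> unit_sphere" and v: "v \<in> tangent_space x"
  have "sphere_d (\<lambda>y. h y *\<^sub>R \<sigma> y) x v = h x *\<^sub>R sphere_d \<sigma> x v + sphere_d h x v *\<^sub>R \<sigma> x"
    by (rule sphere_d_eqI[OF has_derivative_scaleR[OF smooth_has_derivative smooth_has_derivative] x v])
       (use h s x in \<open>simp_all add: section_along_def\<close>)
  moreover have "\<sigma> x \<in> tangent_space (f x)" using s x by (simp add: section_along_def)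
  ultimately show "tproj f (\<lambda>y. h y *\<^sub>R \<sigma> y) x v = sphere_d h x v *\<^sub>R \<sigma> x + h x *\<^sub>R tproj f \<sigma> x v"
    by (simp add: tproj_def extend_add extend_scaleR extend_tangent)
qed

lemma sphere_d_inner:
  fixes f g :: "'a::euclidean_space \<Rightarrow> 'b::euclidean_space"
  assumes "smooth_on_sphere f" "smooth_on_sphere g" "x \<in> unit_sphere" "v \<in> tangent_space x"
  shows "sphere_d (\<lambda>y. f y \<bullet> g y) x v = f x \<bullet> sphere_d g x v + sphere_d f x v \<bullet> g x"
  by (rule sphere_d_eqI[OF has_derivative_inner[OF smooth_has_derivative smooth_has_derivative]])
     (use assms in auto)

lemma is_levi_civita_tproj: "is_levi_civita (tproj (id :: 'a::euclidean_space \<Rightarrow> 'a))"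
  unfolding is_levi_civita_def
proof (intro conjI allI impI ballI)
  show "connection_along id (tproj (id :: 'a \<Rightarrow> 'a))"
    by (rule connection_tproj) (use smooth_id in \<open>auto simp: id_def\<close>)
next
  fix X Y :: "'a \<Rightarrow> 'a" and x :: 'a
  assume X: "vector_field X" and Y: "vector_field Y" and x: "x \<in> unit_sphere"
  have id: "sphere_d (\<lambda>y. y) x v = v" if "v \<in> tangent_space x" for v
    by (rule sphere_d_eqI[OF has_derivative_ident x that])
  have key: "x \<bullet> sphere_d Z x v + v \<bullet> Z x = 0" if Z: "vector_field Z" and v: "v \<in> tangent_space x" for Z v
  proof -
    have "((\<lambda>y. y \<bullet> Z y) has_derivative (\<lambda>_. 0)) (at x within unit_sphere)"
      by (rule has_derivative_transform[OF x _ has_derivative_const[of 0]])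
         (use Z in \<open>auto simp: section_along_def tangent_space_def\<close>)
    then have "sphere_d (\<lambda>y. y \<bullet> Z y) x v = 0" by (rule sphere_d_eqI[OF _ x v])
    then show ?thesis
      using sphere_d_inner[OF smooth_id _ x v, of Z] Z id[OF v] by (simp add: section_along_def)
  qed
  have t: "X x \<in> tangent_space x" "Y x \<in> tangent_space x" using X Y x by (auto simp: section_along_def)
  show "tproj id Y x (X x) - tproj id X x (Y x) = lie_bracket X Y x"
    using key[OF Y t(1)] key[OF X t(2)]
    by (simp add: tproj_def lie_bracket_def extend_diff[symmetric] extend_def inner_diff_right inner_commute)
next
  fix X Y :: "'a \<Rightarrow> 'a" and x v :: 'a
  assume X: "vector_field X" and Y: "vector_field Y" and x: "x \<in> unit_sphere" and v: "v \<in> tangent_space x"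
  have "x \<bullet> X x = 0" "x \<bullet> Y x = 0" using X Y x by (auto simp: section_along_def tangent_space_def)
  then show "sphere_d (\<lambda>y. X y \<bullet> Y y) x v = tproj id X x v \<bullet> Y x + X x \<bullet> tproj id Y x v"
    using sphere_d_inner[OF _ _ x v, of X Y] X Y
    by (simp add: section_along_def tproj_def extend_def inner_diff inner_commute)
qed

lemma is_levi_civita_levi_civita: "is_levi_civita (levi_civita :: ('a::euclidean_space \<Rightarrow> 'a) \<Rightarrow> _)"
  unfolding levi_civita_def by (rule someI[of is_levi_civita, OF is_levi_civita_tproj])

lemma sphere_d_tangent:
  fixes f :: "'a::euclidean_space \<Rightarrow> 'b::euclidean_space"
  assumes f: "smooth_on_sphere f" and fS: "f ` unit_sphere \<subseteq> unit_sphere"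
    and x: "x \<in> unit_sphere" and v: "v \<in> tangent_space x"
  shows "sphere_d f x v \<in> tangent_space (f x)"
proof -
  have "((\<lambda>y. f y \<bullet> f y) has_derivative (\<lambda>_. 0)) (at x within unit_sphere)"
    by (rule has_derivative_transform[OF x _ has_derivative_const[of 1]])
       (use fS in \<open>force simp: norm_eq_1\<close>)
  then have "sphere_d (\<lambda>y. f y \<bullet> f y) x v = 0" by (rule sphere_d_eqI[OF _ x v])
  then show ?thesis
    using sphere_d_inner[OF f f x v] by (simp add: tangent_space_def inner_commute)
qed

lemma smooth_extend:
  assumes "smooth_on_sphere f" "smooth_on_sphere g"
  shows "smooth_on_sphere (\<lambda>x. extend (f x) (g x))"
proof -
  have "smooth_on_sphere (\<lambda>x. f x + (-1) *\<^sub>R ((g x \<bullet> f x) *\<^sub>R g x))"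
    by (intro smooth_add smooth_bilinear[OF bounded_bilinear_scaleR]
        smooth_bilinear[OF bounded_bilinear_inner] smooth_const assms)
  then show ?thesis by (simp add: extend_def)
qed

lemma vector_field_extend: "vector_field (extend w)"
  unfolding section_along_def
  using smooth_extend[OF smooth_const smooth_id, of w] extend_in_tangent by auto

lemma levi_civita_unique:
  fixes D D' :: "('a::euclidean_space \<Rightarrow> 'a) \<Rightarrow> 'a \<Rightarrow> 'a \<Rightarrow> 'a"
  assumes D: "is_levi_civita D" and D': "is_levi_civita D'"
    and Z: "vector_field Z" and x: "x \<in> unit_sphere" and v: "v \<in> tangent_space x"
  shows "D Z x v = D' Z x v"
proof -
  define A where "A Y u = D Y x u - D' Y x u" for Y u
  have sym: "A Y (X x) = A X (Y x)" if "vector_field X" "vector_field Y" for X Y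
  proof -
    have "D Y x (X x) - D X x (Y x) = D' Y x (X x) - D' X x (Y x)"
      using D D' that x unfolding is_levi_civita_def by simp
    then show ?thesis by (simp add: A_def algebra_simps)
  qed
  have skew: "A X u \<bullet> Y x = - (X x \<bullet> A Y u)"
    if "vector_field X" "vector_field Y" "u \<in> tangent_space x" for X Y u
  proof -
    have "sphere_d (\<lambda>y. X y \<bullet> Y y) x u = D X x u \<bullet> Y x + X x \<bullet> D Y x u"
      using D that x unfolding is_levi_civita_def by simp
    moreover have "sphere_d (\<lambda>y. X y \<bullet> Y y) x u = D' X x u \<bullet> Y x + X x \<bullet> D' Y x u"
      using D' that x unfolding is_levi_civita_def by simp
    ultimately show ?thesis by (simp add: A_def algebra_simps inner_diff)
  qed
  have tan: "A Z v \<in> tangent_space x"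
  proof -
    have "vector_field (\<lambda>y. D Z y (extend v y))" "vector_field (\<lambda>y. D' Z y (extend v y))"
      using D D' Z vector_field_extend[of v] unfolding is_levi_civita_def connection_along_def by simp_all
    then have "D Z x (extend v x) \<in> tangent_space x" "D' Z x (extend v x) \<in> tangent_space x"
      using x by (simp_all add: section_along_def)
    then show ?thesis
      by (simp add: A_def extend_tangent[OF v] tangent_space_def inner_diff_right)
  qed
  have "A Z v \<bullet> w = 0" if w: "w \<in> tangent_space x" for w
  proof -
    let ?V = "extend v" and ?W = "extend w"
    have e: "?V x = v" "?W x = w" using v w by (simp_all add: extend_tangent)
    have z: "Z x \<in> tangent_space x" using Z x by (auto simp: section_along_def)
    note vf = Z vector_field_extend[of v] vector_field_extend[of w]
    have "A Z v \<bullet> w = - (Z x \<bullet> A ?W v)" using skew[OF vf(1,3) v] e by simp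
    also have "A ?W v = A ?V w" using sym[OF vf(2,3)] e by simp
    also have "- (Z x \<bullet> A ?V w) = A Z w \<bullet> v" using skew[OF vf(1,2) w] e by simp
    also have "A Z w = A ?W (Z x)" using sym[OF vf(3,1)] e by simp
    also have "A ?W (Z x) \<bullet> v = - (w \<bullet> A ?V (Z x))" using skew[OF vf(3,2) z] e by simp
    also have "A ?V (Z x) = A Z v" using sym[OF vf(2,1)] e by simp
    finally show ?thesis by (simp add: inner_commute)
  qed
  from this[OF tan] show ?thesis by (simp add: A_def)
qed

lemma is_pullback_connection_tproj:
  fixes f :: "'a::euclidean_space \<Rightarrow> 'b::euclidean_space"
  assumes f: "smooth_on_sphere f" and fS: "f ` unit_sphere \<subseteq> unit_sphere"
  shows "is_pullback_connection f (tproj f)"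
  unfolding is_pullback_connection_def
proof (intro conjI allI impI ballI connection_tproj f fS)
  fix Z :: "'b \<Rightarrow> 'b" and x v :: 'a
  assume Z: "vector_field Z" and x: "x \<in> unit_sphere" and v: "v \<in> tangent_space x"
  have y: "f x \<in> unit_sphere" using fS x by blast
  have "(Z has_derivative sphere_d Z (f x)) (at (f x) within f ` unit_sphere)"
    using smooth_has_derivative[OF _ y, of Z] Z fS has_derivative_subset
    by (auto simp: section_along_def)
  from diff_chain_within[OF smooth_has_derivative[OF f x] this]
  have "((\<lambda>y. Z (f y)) has_derivative (\<lambda>v. sphere_d Z (f x) (sphere_d f x v))) (at x within unit_sphere)"
    by (simp add: o_def)
  from sphere_d_eqI[OF this x v]
  have "tproj f (\<lambda>y. Z (f y)) x v = tproj id Z (f x) (sphere_d f x v)" by (simp add: tproj_def)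
  also have "\<dots> = levi_civita Z (f x) (sphere_d f x v)"
    by (rule levi_civita_unique[OF is_levi_civita_tproj is_levi_civita_levi_civita Z y
          sphere_d_tangent[OF f fS x v]])
  finally show "tproj f (\<lambda>y. Z (f y)) x v = levi_civita Z (f x) (sphere_d f x v)" .
qed

lemma is_pullback_connection_pullback_connection:
  fixes f :: "'a::euclidean_space \<Rightarrow> 'b::euclidean_space"
  assumes "smooth_on_sphere f" and "f ` unit_sphere \<subseteq> unit_sphere"
  shows "is_pullback_connection f (pullback_connection f)"
  unfolding pullback_connection_def by (rule someI[of "is_pullback_connection f", OF is_pullback_connection_tproj[OF assms]])

lemma onb_tangent_exists: "\<exists>B. onb_tangent x B"
proof -
  have "subspace (tangent_space x)"
    by (simp add: tangent_space_def subspace_hyperplane)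
  then show ?thesis
    unfolding onb_tangent_def by (metis orthonormal_basis_subspace)
qed

end

theory Submission
  imports Defs
begin

text \<open>
  Every map in question is the restriction to the sphere of a smooth map of the ambient space, so all
  covariant derivatives can be computed there. The pull-back connection is the tangential part of the
  ambient derivative (\<open>pullback_connection_eq_tproj\<close>), because its axioms determine its values on
  sections, and a trace over a tangent space is the ambient trace without the normal direction
  (\<open>metric_trace_bilinear\<close>).

  Write \<open>L\<close> for the trace of the Hessian of the sphere, and \<open>\<langle>dG, dH\<rangle>\<close> for the inner product of the
  differentials along the sphere. For a map \<open>f\<close> between spheres with smooth extension \<open>F\<close>, the
  Gauss formula gives \<open>\<tau> = L F + |dF|\<^sup>2 F\<close>. Differentiating twice more, with a smooth extension
  \<open>T\<close> of \<open>\<tau>\<close> and the curvature \<open>R(X, Y) Z = (Y \<bullet> Z) X - (X \<bullet> Z) Y\<close> of the target, gives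
  \<open>\<tau>\<^sub>2 = L T + (|T|\<^sup>2 + 2 \<langle>dF, dT\<rangle>) F + |dF|\<^sup>2 T\<close> (\<open>bitension_field_eq\<close>); the terms
  \<open>(dF(e) \<bullet> T) dF(e)\<close> in the rough Laplacian and in the curvature trace cancel.

  If \<open>F\<close> is homogeneous, then Euler's identity turns all normal derivatives into multiples: on a map \<open>G\<close>
  of degree \<open>r\<close>, the operator \<open>L\<close> is minus the flat Laplacian minus \<open>r (r + m - 1)\<close>. Writing \<open>A\<close> for
  the flat Laplacian of \<open>F\<close> and \<open>q\<close> for the squared norm of its flat differential, one finds
  \<open>T = (q - k (2 k + m - 1)) F - A\<close>, a sum of homogeneous terms of degrees \<open>3 k - 2\<close>, \<open>k\<close> and
  \<open>k - 2\<close>. What remains is the product rule for the Laplacian of \<open>q F\<close>, which produces the term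
  with the gradient of \<open>q\<close>; the Bochner formula for the Laplacian of \<open>q\<close>, which evaluates the product
  of the differentials of \<open>F\<close> and \<open>A\<close>; and \<open>F \<bullet> T = 0\<close> on the sphere, which evaluates
  \<open>F \<bullet> A\<close>.
\<close>

section \<open>Smooth maps and directional derivatives\<close>

text \<open>Restrictions of such maps to the sphere are differentiated by differentiating on the ambient
  space, where no chart is needed. Directions in \<open>partial\<close> are arbitrary vectors, not only elements
  of the basis.\<close>

definition Cinf :: "('a::euclidean_space \<Rightarrow> 'b::real_normed_vector) \<Rightarrow> bool" where
  "Cinf G \<longleftrightarrow> (\<forall>j. Ck_on j G UNIV)"

lemma Cinf_partial: "Cinf G \<Longrightarrow> Cinf (partial b G)"
  unfolding Cinf_def partial_def[abs_def] using Ck_on.simps(2) by blast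

lemma Cinf_has_derivative: "Cinf G \<Longrightarrow> (G has_derivative (\<lambda>v. partial v G x)) (at x)"
  unfolding Cinf_def partial_def using Ck_on_imp_diff[of 0 G UNIV x] by blast

lemma partialI: "(G has_derivative G') (at x) \<Longrightarrow> partial v G x = G' v"
  unfolding partial_def by (metis frechet_derivative_at)

lemma Cinf_const: "Cinf (\<lambda>x. c)"
  and Cinf_id: "Cinf (\<lambda>x. x)"
  and Cinf_add: "Cinf f \<Longrightarrow> Cinf g \<Longrightarrow> Cinf (\<lambda>x. f x + g x)"
  and Cinf_sum: "(\<And>i. i \<in> I \<Longrightarrow> Cinf (h i)) \<Longrightarrow> Cinf (\<lambda>x. \<Sum>i\<in>I. h i x)"
  by (simp_all add: Cinf_def Ck_on_const Ck_on_id Ck_on_add Ck_on_sum)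

lemma Cinf_bilinear: "bounded_bilinear B \<Longrightarrow> Cinf f \<Longrightarrow> Cinf g \<Longrightarrow> Cinf (\<lambda>x. B (f x) (g x))"
  by (simp add: Cinf_def Ck_on_bilinear)

lemmas Cinf_scaleR = Cinf_bilinear[OF bounded_bilinear_scaleR]
lemmas Cinf_inner = Cinf_bilinear[OF bounded_bilinear_inner]
lemmas Cinf_mult = Cinf_bilinear[OF bounded_bilinear_mult]

lemma Cinf_diff: "Cinf f \<Longrightarrow> Cinf g \<Longrightarrow> Cinf (\<lambda>x. f x - g x)"
  using Cinf_add[of f "\<lambda>x. (-1) *\<^sub>R g x"] Cinf_scaleR[OF Cinf_const[of "-1"], of g] by simp

lemma Cinf_minus: "Cinf f \<Longrightarrow> Cinf (\<lambda>x. - f x)"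
  using Cinf_diff[OF Cinf_const[of 0], of f] by simp

lemmas Cinf_intros = Cinf_const Cinf_id Cinf_add Cinf_diff Cinf_minus Cinf_sum Cinf_scaleR
  Cinf_inner Cinf_mult Cinf_partial

lemma partial_const: "partial v (\<lambda>x. c) = (\<lambda>x. 0)"
  using partialI[OF has_derivative_const] by fast

lemma partial_id: "partial v (\<lambda>x. x) = (\<lambda>x. v)"
  using partialI[OF has_derivative_ident] by fast

lemma partial_bilinear:
  assumes "bounded_bilinear B" "Cinf f" "Cinf g"
  shows "partial v (\<lambda>x. B (f x) (g x)) = (\<lambda>x. B (f x) (partial v g x) + B (partial v f x) (g x))"
  using partialI[OF bounded_bilinear.FDERIV[OF assms(1) Cinf_has_derivative[OF assms(2)]
        Cinf_has_derivative[OF assms(3)]]] by fast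

lemmas partial_scaleR = partial_bilinear[OF bounded_bilinear_scaleR]
lemmas partial_inner = partial_bilinear[OF bounded_bilinear_inner]

lemma partial_add: "Cinf f \<Longrightarrow> Cinf g \<Longrightarrow> partial v (\<lambda>x. f x + g x) = (\<lambda>x. partial v f x + partial v g x)"
  and partial_diff: "Cinf f \<Longrightarrow> Cinf g \<Longrightarrow> partial v (\<lambda>x. f x - g x) = (\<lambda>x. partial v f x - partial v g x)"
  and partial_minus: "Cinf f \<Longrightarrow> partial v (\<lambda>x. - f x) = (\<lambda>x. - partial v f x)"
  and partial_sum: "(\<And>i. i \<in> I \<Longrightarrow> Cinf (h i)) \<Longrightarrow>
    partial v (\<lambda>x. \<Sum>i\<in>I. h i x) = (\<lambda>x. \<Sum>i\<in>I. partial v (h i) x)"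
  by (intro ext partialI has_derivative_add has_derivative_diff has_derivative_minus
      has_derivative_sum Cinf_has_derivative; assumption)+

lemma partial_scaleR_const: "Cinf f \<Longrightarrow> partial v (\<lambda>x. c *\<^sub>R f x) = (\<lambda>x. c *\<^sub>R partial v f x)"
  by (simp add: partial_scaleR Cinf_const partial_const)

lemma linear_partial: "Cinf G \<Longrightarrow> linear (\<lambda>v. partial v G x)"
  using has_derivative_linear[OF Cinf_has_derivative] .

lemma linear_partial_partial:
  assumes G: "Cinf G"
  shows "linear (\<lambda>w. partial v (partial w G) x)"
proof -
  have "partial (a + b) G = (\<lambda>y. partial a G y + partial b G y)"
    and "partial (r *\<^sub>R a) G = (\<lambda>y. r *\<^sub>R partial a G y)" for a b r
    using linear_add[OF linear_partial[OF G]] linear_scale[OF linear_partial[OF G]] by fast+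
  then show ?thesis
    by (intro linearI) (simp_all add: partial_add partial_scaleR_const Cinf_partial G)
qed

lemma linear_Basis_expansion:
  fixes L :: "'a::euclidean_space \<Rightarrow> 'b::real_vector"
  assumes "linear L"
  shows "(\<Sum>b\<in>Basis. (x \<bullet> b) *\<^sub>R L b) = L x"
  using linear_sum[OF assms, of "\<lambda>b. (x \<bullet> b) *\<^sub>R b" Basis] linear_scale[OF assms]
  by (simp add: euclidean_representation)

text \<open>The derivative along the position vector field. Euler's identity says that a map which is
  homogeneous of degree \<open>r\<close> is an eigenvector of this operator with eigenvalue \<open>r\<close>; on the sphere
  it is the derivative in the unit normal direction.\<close>

definition euler :: "('a::euclidean_space \<Rightarrow> 'b::real_normed_vector) \<Rightarrow> 'a \<Rightarrow> 'b" where
  "euler G y = partial y G y"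

lemma euler_Basis:
  assumes "Cinf G"
  shows "euler G = (\<lambda>y. \<Sum>b\<in>Basis. (y \<bullet> b) *\<^sub>R partial b G y)"
  using linear_Basis_expansion[OF linear_partial[OF assms]] by (simp add: euler_def fun_eq_iff)

lemma Cinf_euler: "Cinf G \<Longrightarrow> Cinf (euler G)"
  unfolding euler_Basis by (intro Cinf_intros)

text \<open>The two terms come from the two places where \<open>y\<close> occurs in \<open>partial y G y\<close>.\<close>

lemma partial_euler:
  assumes G: "Cinf G"
  shows "partial v (euler G) x = partial v G x + partial v (partial x G) x"
proof -
  have "partial v (euler G) x =
      (\<Sum>b\<in>Basis. (x \<bullet> b) *\<^sub>R partial v (partial b G) x) + (\<Sum>b\<in>Basis. (v \<bullet> b) *\<^sub>R partial b G x)"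
    unfolding euler_Basis[OF G]
    by (simp add: partial_sum partial_scaleR partial_inner partial_const partial_id Cinf_intros G
        sum.distrib)
  then show ?thesis
    by (simp add: linear_Basis_expansion linear_partial linear_partial_partial G)
qed

text \<open>The left-hand side is symmetric in \<open>a\<close> and \<open>b\<close>, which is what makes mixed partial
  derivatives commute. The mean value theorem is used once in each direction: for the difference
  \<open>G (y + h b) - G y\<close> along \<open>a\<close>, and then for \<open>partial a G\<close> along \<open>b\<close>.\<close>

lemma second_difference_mean_value:
  fixes G :: "'a::euclidean_space \<Rightarrow> real"
  assumes G: "Cinf G" and h: "h > 0"
  shows "\<exists>s\<in>{0..h}. \<exists>t\<in>{0..h}.
    G (x + h *\<^sub>R a + h *\<^sub>R b) - G (x + h *\<^sub>R a) - G (x + h *\<^sub>R b) + G x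
      = h * h * partial b (partial a G) (x + s *\<^sub>R a + t *\<^sub>R b)"
proof -
  have along: "((\<lambda>s. H (p + s *\<^sub>R w)) has_derivative (\<lambda>d. d * partial w H (p + s *\<^sub>R w))) (at s within T)"
    if H: "Cinf H" for H :: "'a \<Rightarrow> real" and p w s T
  proof -
    have "((\<lambda>s. p + s *\<^sub>R w) has_derivative (\<lambda>d. d *\<^sub>R w)) (at s within T)"
      by (auto intro!: derivative_eq_intros)
    from has_derivative_compose[OF this Cinf_has_derivative[OF H]] show ?thesis
      by (simp add: linear_scale[OF linear_partial[OF H]])
  qed
  have "\<exists>s\<in>{0..h}. (G (x + h *\<^sub>R b + h *\<^sub>R a) - G (x + h *\<^sub>R a)) - (G (x + h *\<^sub>R b + 0 *\<^sub>R a) - G (x + 0 *\<^sub>R a))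
      = (h - 0) * partial a G (x + h *\<^sub>R b + s *\<^sub>R a) - (h - 0) * partial a G (x + s *\<^sub>R a)"
    by (rule mvt_very_simple) (use h in \<open>auto intro!: has_derivative_diff along G\<close>)
  then obtain s where s: "s \<in> {0..h}" and
    1: "G (x + h *\<^sub>R a + h *\<^sub>R b) - G (x + h *\<^sub>R a) - G (x + h *\<^sub>R b) + G x
      = h * (partial a G (x + s *\<^sub>R a + h *\<^sub>R b) - partial a G (x + s *\<^sub>R a))"
    by (auto simp: algebra_simps)
  have "\<exists>t\<in>{0..h}. partial a G (x + s *\<^sub>R a + h *\<^sub>R b) - partial a G (x + s *\<^sub>R a + 0 *\<^sub>R b)
      = (h - 0) * partial b (partial a G) (x + s *\<^sub>R a + t *\<^sub>R b)"
    by (rule mvt_very_simple) (use h in \<open>auto intro!: along Cinf_partial G\<close>)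
  with 1 s show ?thesis by auto
qed

text \<open>Both mixed derivatives are the limit of one and the same second difference quotient.\<close>

lemma partial_commute_real:
  fixes G :: "'a::euclidean_space \<Rightarrow> real"
  assumes G: "Cinf G"
  shows "partial a (partial b G) x = partial b (partial a G) x"
proof -
  define h where "h n = inverse (real (Suc n))" for n
  have h: "h n > 0" for n by (simp add: h_def)
  have h0: "h \<longlonglongrightarrow> 0" unfolding h_def by (rule LIMSEQ_inverse_real_of_nat)
  define Q where "Q n = (G (x + h n *\<^sub>R a + h n *\<^sub>R b) - G (x + h n *\<^sub>R a) - G (x + h n *\<^sub>R b) + G x)
    / (h n * h n)" for n
  have lim: "Q \<longlonglongrightarrow> partial v (partial u G) x"
    if "\<And>n. \<exists>s\<in>{0..h n}. \<exists>t\<in>{0..h n}. Q n = partial v (partial u G) (x + s *\<^sub>R u + t *\<^sub>R v)" for u v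
  proof -
    from that obtain s t where st: "\<And>n. s n \<in> {0..h n}" "\<And>n. t n \<in> {0..h n}"
      and Q: "\<And>n. Q n = partial v (partial u G) (x + s n *\<^sub>R u + t n *\<^sub>R v)"
      by metis
    have "s \<longlonglongrightarrow> 0" "t \<longlonglongrightarrow> 0"
      using st by (auto intro: tendsto_sandwich[OF _ _ tendsto_const h0])
    then have p: "(\<lambda>n. x + s n *\<^sub>R u + t n *\<^sub>R v) \<longlonglongrightarrow> x + 0 *\<^sub>R u + 0 *\<^sub>R v"
      by (intro tendsto_intros)
    have "isCont (partial v (partial u G)) x"
      using has_derivative_continuous[OF Cinf_has_derivative] G Cinf_partial by blast
    from isCont_tendsto_compose[OF this, of _ sequentially] p show ?thesis
      unfolding Q[abs_def] by simp
  qed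
  have "Q \<longlonglongrightarrow> partial b (partial a G) x"
  proof (rule lim)
    fix n show "\<exists>s\<in>{0..h n}. \<exists>t\<in>{0..h n}. Q n = partial b (partial a G) (x + s *\<^sub>R a + t *\<^sub>R b)"
      using second_difference_mean_value[OF G h[of n], of x a b] h[of n] by (force simp: Q_def)
  qed
  moreover have "Q \<longlonglongrightarrow> partial a (partial b G) x"
  proof (rule lim)
    fix n show "\<exists>s\<in>{0..h n}. \<exists>t\<in>{0..h n}. Q n = partial a (partial b G) (x + s *\<^sub>R b + t *\<^sub>R a)"
      using second_difference_mean_value[OF G h[of n], of x b a] h[of n]
      by (force simp: Q_def algebra_simps)
  qed
  ultimately show ?thesis by (rule LIMSEQ_unique[symmetric])
qed

lemma partial_commute:
  fixes G :: "'a::euclidean_space \<Rightarrow> 'b::euclidean_space"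
  assumes G: "Cinf G"
  shows "partial a (partial b G) x = partial b (partial a G) x"
proof (rule euclidean_eqI)
  fix c :: 'b
  have "partial u (partial v (\<lambda>y. G y \<bullet> c)) x = partial u (partial v G) x \<bullet> c" for u v
    by (simp add: partial_inner partial_const Cinf_intros G)
  then show "partial a (partial b G) x \<bullet> c = partial b (partial a G) x \<bullet> c"
    using partial_commute_real[of "\<lambda>y. G y \<bullet> c" a b x] by (simp add: Cinf_intros G)
qed

section \<open>Uniqueness of the pull-back connection\<close>

lemma connection_along_scaleR:
  assumes "connection_along f D" "smooth_on_sphere h" "section_along f \<sigma>"
    and "x \<in> unit_sphere" "v \<in> tangent_space x"
  shows "D (\<lambda>y. h y *\<^sub>R \<sigma> y) x v = sphere_d h x v *\<^sub>R \<sigma> x + h x *\<^sub>R D \<sigma> x v"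
  using assms unfolding connection_along_def by simp

text \<open>Two sections that agree on the sphere may differ elsewhere, while a connection takes total
  functions as arguments. The Leibniz rule removes the ambiguity: a section that vanishes on the
  sphere is unchanged by multiplication with the function that is \<open>0\<close> on the sphere and \<open>1\<close>
  elsewhere, and this function is smooth on the sphere.\<close>

lemma connection_along_zero:
  assumes D: "connection_along f D" and s: "section_along f \<sigma>" and z: "\<And>y. y \<in> unit_sphere \<Longrightarrow> \<sigma> y = 0"
    and x: "x \<in> unit_sphere" and v: "v \<in> tangent_space x"
  shows "D \<sigma> x v = 0"
proof -
  define h :: "'a \<Rightarrow> real" where "h y = (if y \<in> unit_sphere then 0 else 1)" for y
  have "smooth_on_sphere h"
    unfolding smooth_on_sphere_def
    by (intro ballI smooth_witness[of UNIV _ "\<lambda>_. 0"]) (auto simp: Ck_on_const h_def)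
  moreover have "(\<lambda>y. h y *\<^sub>R \<sigma> y) = \<sigma>" by (auto simp: h_def z)
  ultimately have "D \<sigma> x v = sphere_d h x v *\<^sub>R \<sigma> x + h x *\<^sub>R D \<sigma> x v"
    using connection_along_scaleR[OF D _ s x v, of h] by simp
  then show ?thesis using x by (simp add: z h_def)
qed

lemma section_along_scaleR:
  assumes "smooth_on_sphere h" "section_along f \<sigma>"
  shows "section_along f (\<lambda>y. h y *\<^sub>R \<sigma> y)"
  using assms by (simp add: section_along_def smooth_bilinear[OF bounded_bilinear_scaleR] tangent_space_def)

lemma section_along_add:
  assumes "section_along f \<sigma>" "section_along f \<rho>"
  shows "section_along f (\<lambda>y. \<sigma> y + \<rho> y)"
  using assms by (simp add: section_along_def smooth_add tangent_space_def inner_add_right)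

lemma section_along_sum:
  assumes "\<And>i. i \<in> I \<Longrightarrow> section_along f (\<sigma> i)"
  shows "section_along f (\<lambda>y. \<Sum>i\<in>I. \<sigma> i y)"
  using assms
proof (induction I rule: infinite_finite_induct)
  case (insert i I) then show ?case by (simp add: section_along_add)
qed (simp_all add: section_along_def smooth_const tangent_space_def)

lemma section_along_extend:
  assumes "smooth_on_sphere f" "f ` unit_sphere \<subseteq> unit_sphere"
  shows "section_along f (\<lambda>y. extend b (f y))"
  unfolding section_along_def
  using assms(2) smooth_extend[OF smooth_const assms(1), of b] extend_in_tangent by blast

lemma connection_along_cong:
  assumes D: "connection_along f D" and s: "section_along f \<sigma>" and r: "section_along f \<rho>"
    and eq: "\<And>y. y \<in> unit_sphere \<Longrightarrow> \<sigma> y = \<rho> y"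
    and x: "x \<in> unit_sphere" and v: "v \<in> tangent_space x"
  shows "D \<sigma> x v = D \<rho> x v"
proof -
  define \<delta> where "\<delta> y = \<sigma> y + (-1) *\<^sub>R \<rho> y" for y
  have d: "section_along f \<delta>"
    unfolding \<delta>_def[abs_def] by (intro section_along_add s section_along_scaleR smooth_const r)
  have "\<sigma> = (\<lambda>y. \<rho> y + \<delta> y)" by (simp add: \<delta>_def fun_eq_iff)
  then have "D \<sigma> x v = D \<rho> x v + D \<delta> x v"
    using D r d x v unfolding connection_along_def by simp
  also have "D \<delta> x v = 0"
    by (rule connection_along_zero[OF D d _ x v]) (simp add: \<delta>_def eq)
  finally show ?thesis by simp
qed

lemma connection_along_sum:
  assumes D: "connection_along f D" and s: "\<And>i. i \<in> I \<Longrightarrow> section_along f (\<sigma> i)"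
    and x: "x \<in> unit_sphere" and v: "v \<in> tangent_space x"
  shows "D (\<lambda>y. \<Sum>i\<in>I. \<sigma> i y) x v = (\<Sum>i\<in>I. D (\<sigma> i) x v)"
  using s
proof (induction I rule: infinite_finite_induct)
  case (insert i I)
  then have "D (\<lambda>y. \<sigma> i y + (\<Sum>i\<in>I. \<sigma> i y)) x v = D (\<sigma> i) x v + D (\<lambda>y. \<Sum>i\<in>I. \<sigma> i y) x v"
    using D x v section_along_sum[of I f \<sigma>] unfolding connection_along_def by simp
  with insert show ?case by simp
next
  case (infinite A)
  then show ?case
    using connection_along_zero[OF D _ _ x v, of "\<lambda>_. 0"] section_along_sum[of "{}" f \<sigma>] by simp
next
  case empty
  then show ?case
    using connection_along_zero[OF D _ _ x v, of "\<lambda>_. 0"] section_along_sum[of "{}" f \<sigma>] by simp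
qed

text \<open>The vector fields \<open>extend b\<close> along \<open>f\<close>, for \<open>b\<close> in the basis, generate all
  sections: a tangent vector is the combination of the tangential parts of the basis vectors with its
  own coordinates as coefficients. Additivity and the Leibniz rule do the rest.\<close>

lemma connection_along_unique:
  fixes f :: "'a::euclidean_space \<Rightarrow> 'b::euclidean_space"
  assumes D: "connection_along f D" and D': "connection_along f D'"
    and f: "smooth_on_sphere f" "f ` unit_sphere \<subseteq> unit_sphere"
    and eq: "\<And>b. D (\<lambda>y. extend b (f y)) x v = D' (\<lambda>y. extend b (f y)) x v"
    and s: "section_along f \<sigma>" and x: "x \<in> unit_sphere" and v: "v \<in> tangent_space x"
  shows "D \<sigma> x v = D' \<sigma> x v"
proof -
  define \<rho> where "\<rho> b y = (\<sigma> y \<bullet> b) *\<^sub>R extend b (f y)" for b y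
  have ext: "section_along f (\<lambda>y. extend b (f y))" for b by (rule section_along_extend[OF f])
  have c: "smooth_on_sphere (\<lambda>y. \<sigma> y \<bullet> b)" for b
    using s by (simp add: section_along_def smooth_bilinear[OF bounded_bilinear_inner] smooth_const)
  have \<rho>: "section_along f (\<rho> b)" for b
    unfolding \<rho>_def[abs_def] by (rule section_along_scaleR[OF c ext])
  have expand: "\<sigma> y = (\<Sum>b\<in>Basis. \<rho> b y)" if y: "y \<in> unit_sphere" for y
  proof -
    have "(\<Sum>b\<in>Basis. \<rho> b y) = (\<Sum>b\<in>Basis. (\<sigma> y \<bullet> b) *\<^sub>R b) - (\<Sum>b\<in>Basis. (\<sigma> y \<bullet> b) * (f y \<bullet> b)) *\<^sub>R f y"
      by (simp add: \<rho>_def extend_def algebra_simps sum_subtractf scaleR_sum_left)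
    also have "(\<Sum>b\<in>Basis. (\<sigma> y \<bullet> b) * (f y \<bullet> b)) = \<sigma> y \<bullet> f y" by (rule euclidean_inner[symmetric])
    also have "\<sigma> y \<bullet> f y = 0"
      using s y by (simp add: section_along_def tangent_space_def inner_commute)
    finally show ?thesis by (simp add: euclidean_representation)
  qed
  have E: "E \<sigma> x v = (\<Sum>b\<in>Basis. sphere_d (\<lambda>y. \<sigma> y \<bullet> b) x v *\<^sub>R extend b (f x)
      + (\<sigma> x \<bullet> b) *\<^sub>R E (\<lambda>y. extend b (f y)) x v)" if E: "connection_along f E" for E
  proof -
    have "E \<sigma> x v = E (\<lambda>y. \<Sum>b\<in>Basis. \<rho> b y) x v"
      by (rule connection_along_cong[OF E s section_along_sum[OF \<rho>] expand x v])
    also have "\<dots> = (\<Sum>b\<in>Basis. E (\<rho> b) x v)"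
      by (rule connection_along_sum[OF E \<rho> x v])
    also have "\<dots> = (\<Sum>b\<in>Basis. sphere_d (\<lambda>y. \<sigma> y \<bullet> b) x v *\<^sub>R extend b (f x)
        + (\<sigma> x \<bullet> b) *\<^sub>R E (\<lambda>y. extend b (f y)) x v)"
    proof (rule sum.cong[OF refl])
      fix b
      show "E (\<rho> b) x v = sphere_d (\<lambda>y. \<sigma> y \<bullet> b) x v *\<^sub>R extend b (f x)
          + (\<sigma> x \<bullet> b) *\<^sub>R E (\<lambda>y. extend b (f y)) x v"
        using connection_along_scaleR[OF E c ext x v] unfolding \<rho>_def[abs_def] .
    qed
    finally show ?thesis .
  qed
  show ?thesis by (simp add: E[OF D] E[OF D'] eq)
qed

text \<open>On sections pulled back from the target, both sides are given by the Levi-Civita connection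
  there; hence they agree everywhere.\<close>

lemma pullback_connection_eq_tproj:
  fixes f :: "'a::euclidean_space \<Rightarrow> 'b::euclidean_space"
  assumes f: "smooth_on_sphere f" "f ` unit_sphere \<subseteq> unit_sphere"
    and s: "section_along f \<sigma>" and x: "x \<in> unit_sphere" and v: "v \<in> tangent_space x"
  shows "pullback_connection f \<sigma> x v = tproj f \<sigma> x v"
proof -
  note P = is_pullback_connection_pullback_connection[OF f]
    and T = is_pullback_connection_tproj[OF f]
  show ?thesis
  proof (rule connection_along_unique[OF _ _ f _ s x v])
    fix b show "pullback_connection f (\<lambda>y. extend b (f y)) x v = tproj f (\<lambda>y. extend b (f y)) x v"
      using P T vector_field_extend[of b] x v unfolding is_pullback_connection_def by simp
  qed (use P T in \<open>simp_all add: is_pullback_connection_def\<close>)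
qed

lemma levi_civita_eq_tproj:
  assumes "vector_field Z" "x \<in> unit_sphere" "v \<in> tangent_space x"
  shows "levi_civita Z x v = tproj id Z x v"
  using levi_civita_unique[OF is_levi_civita_levi_civita is_levi_civita_tproj assms] .

section \<open>Traces over tangent spaces\<close>

lemma orthonormal_trace:
  fixes B :: "'a::euclidean_space \<Rightarrow> 'a \<Rightarrow> 'b::real_vector"
  assumes B: "bilinear B" and C: "finite C" "pairwise orthogonal C" "\<And>c. c \<in> C \<Longrightarrow> norm c = 1"
    "span C = UNIV"
  shows "(\<Sum>c\<in>C. B c c) = (\<Sum>b\<in>Basis. B b b)"
proof -
  have l: "linear (B x)" "linear (\<lambda>x. B x y)" for x y using B by (simp_all add: bilinear_def)
  have 1: "B b b' = (\<Sum>c\<in>C. (b' \<bullet> c) *\<^sub>R B b c)" for b b'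
  proof -
    have "B b b' = B b (\<Sum>c\<in>C. (b' \<bullet> c) *\<^sub>R c)"
      using orthonormal_basis_expand[OF C(2,3) _ C(1), of b'] C(4) by simp
    then show ?thesis by (simp add: linear_sum[OF l(1)] linear_scale[OF l(1)])
  qed
  have "(\<Sum>b\<in>Basis. B b b) = (\<Sum>b\<in>Basis. \<Sum>c\<in>C. (b \<bullet> c) *\<^sub>R B b c)"
    by (rule sum.cong[OF refl]) (rule 1)
  also have "\<dots> = (\<Sum>c\<in>C. \<Sum>b\<in>Basis. (c \<bullet> b) *\<^sub>R B b c)"
    by (subst sum.swap) (simp add: inner_commute)
  also have "\<dots> = (\<Sum>c\<in>C. B c c)"
    using linear_Basis_expansion[OF l(2)] by simp
  finally show ?thesis by simp
qed

text \<open>An orthonormal basis of the tangent space together with the unit normal \<open>x\<close> is an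
  orthonormal basis of the ambient space, and the trace does not depend on that basis.\<close>

lemma metric_trace_bilinear:
  fixes B :: "'a::euclidean_space \<Rightarrow> 'a \<Rightarrow> 'b::real_vector"
  assumes x: "x \<in> unit_sphere" and B: "bilinear B"
    and \<beta>: "\<And>e. e \<in> tangent_space x \<Longrightarrow> \<beta> e e = B e e"
  shows "metric_trace x \<beta> = (\<Sum>b\<in>Basis. B b b) - B x x"
proof -
  define C where "C = (SOME B. onb_tangent x B)"
  have "onb_tangent x C" unfolding C_def by (rule someI_ex[OF onb_tangent_exists])
  then have C: "pairwise orthogonal C" "\<And>e. e \<in> C \<Longrightarrow> norm e = 1" "span C = tangent_space x"
    by (auto simp: onb_tangent_def)
  have xx: "x \<bullet> x = 1" using x by (simp add: norm_eq_1)
  have t: "e \<in> tangent_space x" if "e \<in> C" for e using C(3) span_base that by blast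
  then have xC: "x \<notin> C" using xx by (auto simp: tangent_space_def)
  have "independent C"
    by (rule pairwise_orthogonal_independent[OF C(1)]) (use C(2) in force)
  then have fin: "finite C" by (rule independent_imp_finite)
  have "pairwise orthogonal (insert x C)"
    using C(1) t by (auto simp: pairwise_insert orthogonal_def tangent_space_def inner_commute)
  moreover have "span (insert x C) = UNIV"
  proof -
    have "y - (x \<bullet> y) *\<^sub>R x \<in> span C" for y
      using xx by (simp add: C(3) tangent_space_def inner_diff_right)
    then show ?thesis by (auto simp: span_insert)
  qed
  ultimately have "(\<Sum>c\<in>insert x C. B c c) = (\<Sum>b\<in>Basis. B b b)"
    using fin C(2) x by (intro orthonormal_trace[OF B]) auto
  moreover have "metric_trace x \<beta> = (\<Sum>c\<in>C. B c c)"
    unfolding metric_trace_def C_def[symmetric] by (rule sum.cong) (simp_all add: \<beta> t)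
  ultimately show ?thesis using xC fin by (simp add: algebra_simps)
qed

section \<open>Second order calculus on the sphere by ambient extensions\<close>

lemma sphere_d_Cinf:
  assumes G: "Cinf G" and fG: "\<And>y. y \<in> unit_sphere \<Longrightarrow> f y = G y"
    and x: "x \<in> unit_sphere" and v: "v \<in> tangent_space x"
  shows "sphere_d f x v = partial v G x"
proof -
  have "(f has_derivative (\<lambda>v. partial v G x)) (at x within unit_sphere)"
    by (rule has_derivative_transform[OF x fG has_derivative_at_withinI[OF Cinf_has_derivative[OF G]]])
  from sphere_d_eqI[OF this x v] show ?thesis .
qed

lemma smooth_on_sphere_Cinf:
  assumes "Cinf G" and "\<And>y. y \<in> unit_sphere \<Longrightarrow> f y = G y"
  shows "smooth_on_sphere f"
  unfolding smooth_on_sphere_def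
  by (intro ballI smooth_witness[of UNIV _ G]) (use assms in \<open>auto simp: Cinf_def\<close>)

lemma partial_tangent_zero:
  assumes G: "Cinf G" and c: "\<And>y. y \<in> unit_sphere \<Longrightarrow> G y = c"
    and x: "x \<in> unit_sphere" and v: "v \<in> tangent_space x"
  shows "partial v G x = 0"
  using sphere_d_Cinf[OF G _ x v, of "\<lambda>_. c"] sphere_d_Cinf[OF Cinf_const _ x v, of "\<lambda>_. c" c] c
  by (simp add: partial_const)

lemma zero_in_tangent_space: "0 \<in> tangent_space x"
  by (simp add: tangent_space_def)

lemma extend_eq: "extend w = (\<lambda>y. w - (y \<bullet> w) *\<^sub>R y)"
  by (simp add: extend_def fun_eq_iff)

lemma Cinf_extend: "Cinf f \<Longrightarrow> Cinf g \<Longrightarrow> Cinf (\<lambda>y. extend (f y) (g y))"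
  unfolding extend_eq by (intro Cinf_intros)

lemma partial_extend: "partial v (extend w) x = - (x \<bullet> w) *\<^sub>R v - (v \<bullet> w) *\<^sub>R x"
  unfolding extend_eq
  by (simp add: partial_diff partial_scaleR partial_inner partial_const partial_id Cinf_intros)

text \<open>On tangent vectors, this is the covariant Hessian on the sphere of the restriction of \<open>G\<close>. The
  correction is the second fundamental form of the sphere in the ambient space, paired with the
  normal derivative of \<open>G\<close>.\<close>

definition sphere_hess :: "('a::euclidean_space \<Rightarrow> 'b::real_normed_vector) \<Rightarrow> 'a \<Rightarrow> 'a \<Rightarrow> 'a \<Rightarrow> 'b" where
  "sphere_hess G x v w = partial v (partial w G) x - (v \<bullet> w) *\<^sub>R euler G x"

lemma partial_extend_direction:
  assumes "Cinf G"
  shows "(\<lambda>y. partial (extend w y) G y) = (\<lambda>y. partial w G y - (y \<bullet> w) *\<^sub>R euler G y)"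
  using linear_diff[OF linear_partial[OF assms]] linear_scale[OF linear_partial[OF assms]]
  by (simp add: extend_def euler_def fun_eq_iff)

lemma Cinf_partial_extend_direction: "Cinf G \<Longrightarrow> Cinf (\<lambda>y. partial (extend w y) G y)"
  unfolding partial_extend_direction by (intro Cinf_intros Cinf_euler)

text \<open>Where \<open>w\<close> is tangent, the ambient derivative of \<open>extend w\<close> in direction \<open>v\<close> is the normal
  vector \<open>- (v \<bullet> w) x\<close>; it accounts for the correction term of \<open>sphere_hess\<close>.\<close>

lemma partial_partial_extend:
  assumes G: "Cinf G" and w: "w \<in> tangent_space x"
  shows "partial v (\<lambda>y. partial (extend w y) G y) x = sphere_hess G x v w"
  using w unfolding partial_extend_direction[OF G]
  by (simp add: partial_diff partial_scaleR partial_inner partial_const partial_id Cinf_intros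
      Cinf_euler G sphere_hess_def tangent_space_def)

lemma bilinear_sphere_hess: "Cinf G \<Longrightarrow> bilinear (sphere_hess G x)"
  unfolding bilinear_def sphere_hess_def
  by (intro conjI allI linear_compose_sub linear_partial linear_partial_partial Cinf_partial)
     (simp_all add: linear_iff inner_add algebra_simps)

text \<open>The trace of \<open>sphere_hess\<close> over the tangent space, so the sign is opposite to that of
  \<open>flat_laplacian\<close>.\<close>

definition sphere_laplacian :: "('a::euclidean_space \<Rightarrow> 'b::real_normed_vector) \<Rightarrow> 'a \<Rightarrow> 'b" where
  "sphere_laplacian G x = (\<Sum>b\<in>Basis. sphere_hess G x b b) - sphere_hess G x x x"

lemma sphere_laplacian_eq:
  fixes G :: "'a::euclidean_space \<Rightarrow> 'b::real_normed_vector"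
  assumes G: "Cinf G" and x: "x \<in> unit_sphere"
  shows "sphere_laplacian G x =
    - flat_laplacian G x - euler (euler G) x - (real DIM('a) - 2) *\<^sub>R euler G x"
proof -
  have "euler (euler G) x = euler G x + partial x (partial x G) x"
    unfolding euler_def[of "euler G"] partial_euler[OF G] by (simp add: euler_def)
  moreover have "x \<bullet> x = 1" using x by (simp add: norm_eq_1)
  moreover have "(\<Sum>b\<in>(Basis::'a set). (b \<bullet> b) *\<^sub>R euler G x) = real DIM('a) *\<^sub>R euler G x"
    by (simp add: sum_constant_scaleR)
  ultimately show ?thesis
    by (simp add: sphere_laplacian_def sphere_hess_def flat_laplacian_def sum_subtractf
        algebra_simps scaleR_2)
qed

text \<open>Only the values on the sphere enter the Laplacian of the sphere. Applied to inner products that are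
  constant there, such as \<open>F \<bullet> F\<close>, this yields relations for \<open>F\<close> without a formula for these
  products off the sphere.\<close>

lemma sphere_laplacian_of_constant:
  assumes G: "Cinf G" and c: "\<And>y. y \<in> unit_sphere \<Longrightarrow> G y = c" and x: "x \<in> unit_sphere"
  shows "sphere_laplacian G x = 0"
proof -
  have "sphere_hess G x e e = 0" if e: "e \<in> tangent_space x" for e
  proof -
    have "partial (extend e y) G y = 0" if "y \<in> unit_sphere" for y
      by (rule partial_tangent_zero[OF G c that extend_in_tangent[OF that]])
    from partial_tangent_zero[OF Cinf_partial_extend_direction[OF G] this x e]
    show ?thesis by (simp add: partial_partial_extend[OF G e])
  qed
  then have "metric_trace x (\<lambda>_ _. 0) = sphere_laplacian G x"
    unfolding sphere_laplacian_def
    by (intro metric_trace_bilinear[OF x bilinear_sphere_hess[OF G]]) simp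
  then show ?thesis by (simp add: metric_trace_def)
qed

text \<open>The Hilbert-Schmidt inner product of the differentials of the two restrictions to the sphere: the
  normal direction is removed from the ambient trace.\<close>

definition sphere_d_inner_d ::
  "('a::euclidean_space \<Rightarrow> 'b::euclidean_space) \<Rightarrow> ('a \<Rightarrow> 'b) \<Rightarrow> 'a \<Rightarrow> real" where
  "sphere_d_inner_d G H x = (\<Sum>b\<in>Basis. partial b G x \<bullet> partial b H x) - euler G x \<bullet> euler H x"

lemma sphere_laplacian_inner:
  assumes G: "Cinf G" and H: "Cinf H"
  shows "sphere_laplacian (\<lambda>y. G y \<bullet> H y) x =
    G x \<bullet> sphere_laplacian H x + sphere_laplacian G x \<bullet> H x + 2 * sphere_d_inner_d G H x"
proof -
  have "euler (\<lambda>y. G y \<bullet> H y) x = G x \<bullet> euler H x + euler G x \<bullet> H x"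
    by (simp add: euler_def partial_inner G H)
  then have "sphere_hess (\<lambda>y. G y \<bullet> H y) x v w =
      G x \<bullet> sphere_hess H x v w + sphere_hess G x v w \<bullet> H x
      + partial v G x \<bullet> partial w H x + partial w G x \<bullet> partial v H x" for v w
    by (simp add: sphere_hess_def partial_inner partial_add Cinf_intros G H inner_diff_left
        inner_diff_right algebra_simps)
  then show ?thesis
    by (simp add: sphere_laplacian_def sphere_d_inner_d_def sum.distrib inner_sum_left inner_sum_right
        inner_diff_left inner_diff_right euler_def sum_distrib_left algebra_simps)
qed

section \<open>Curvature of the unit sphere\<close>

lemma levi_civita_extend:
  assumes y: "y \<in> unit_sphere" and v: "v \<in> tangent_space y"
  shows "levi_civita (extend w) y v = - (y \<bullet> w) *\<^sub>R v"
proof -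
  have "sphere_d (extend w) y v = - (y \<bullet> w) *\<^sub>R v - (v \<bullet> w) *\<^sub>R y"
    using sphere_d_Cinf[OF Cinf_extend[OF Cinf_const Cinf_id] _ y v, of "extend w" w]
    by (simp add: partial_extend)
  moreover have "extend y y = 0" using y by (simp add: extend_def norm_eq_1)
  ultimately show ?thesis
    unfolding levi_civita_eq_tproj[OF vector_field_extend y v] tproj_def
    by (simp only: extend_diff extend_scaleR extend_tangent[OF v] id_apply) simp
qed

text \<open>The field \<open>extend w\<close> has covariant derivative \<open>- (z \<bullet> w) v\<close> in direction \<open>v\<close>,
  a multiple of \<open>v\<close> whose factor vanishes at \<open>y\<close>. So only the derivative of this factor
  survives in the second derivative, and the bracket of \<open>extend u\<close> and \<open>extend v\<close> vanishes at
  \<open>y\<close>.\<close>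

lemma curvature_unit_sphere:
  assumes y: "y \<in> unit_sphere"
    and t: "u \<in> tangent_space y" "v \<in> tangent_space y" "w \<in> tangent_space y"
  shows "curvature y u v w = (v \<bullet> w) *\<^sub>R u - (u \<bullet> w) *\<^sub>R v"
proof -
  \<comment> \<open>On the sphere the inner field is \<open>z \<mapsto> - (z \<bullet> w) *\<^sub>R extend b z\<close>.\<close>
  have LC: "levi_civita (\<lambda>z. levi_civita (extend w) z (extend b z)) y a = - (a \<bullet> w) *\<^sub>R b"
    if a: "a \<in> tangent_space y" and b: "b \<in> tangent_space y" for a b
  proof -
    define Z where "Z z = levi_civita (extend w) z (extend b z)" for z
    define G where "G z = (- (z \<bullet> w)) *\<^sub>R extend b z" for z
    have G: "Cinf G" unfolding G_def[abs_def] extend_eq by (intro Cinf_intros)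
    have ZG: "Z z = G z" if "z \<in> unit_sphere" for z
      using levi_civita_extend[OF that extend_in_tangent[OF that]] by (simp add: Z_def G_def)
    have Z: "vector_field Z"
      using smooth_on_sphere_Cinf[OF G ZG] extend_in_tangent ZG
      by (fastforce simp: section_along_def G_def tangent_space_def)
    have "partial a G y = - (a \<bullet> w) *\<^sub>R b"
      unfolding G_def[abs_def] using t(3) b
      by (simp add: partial_minus partial_scaleR partial_inner partial_const partial_id Cinf_intros
          Cinf_extend[OF Cinf_const Cinf_id] tangent_space_def extend_def)
    with sphere_d_Cinf[OF G ZG y a] levi_civita_eq_tproj[OF Z y a]
    have "levi_civita Z y a = extend (- (a \<bullet> w) *\<^sub>R b) y" by (simp add: tproj_def)
    then show ?thesis by (simp only: extend_scaleR extend_tangent[OF b] Z_def[abs_def])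
  qed
  have d: "sphere_d (extend b) y a = - (a \<bullet> b) *\<^sub>R y"
    if "a \<in> tangent_space y" "b \<in> tangent_space y" for a b
    using sphere_d_Cinf[OF Cinf_extend[OF Cinf_const Cinf_id] _ y that(1), of "extend b" b] that
    by (simp add: partial_extend tangent_space_def)
  have "lie_bracket (extend u) (extend v) y = 0"
    unfolding lie_bracket_def extend_tangent[OF t(1)] extend_tangent[OF t(2)]
    by (simp only: d t) (simp add: inner_commute)
  moreover have "levi_civita (extend w) y 0 = 0"
    using levi_civita_extend[OF y zero_in_tangent_space] by simp
  ultimately show ?thesis by (simp add: curvature_def LC t)
qed

lemma linear_extend: "linear (\<lambda>v. extend v y)"
  by (intro linearI extend_add extend_scaleR)

lemma bilinear_extend: "bilinear B \<Longrightarrow> bilinear (\<lambda>v w. extend (B v w) y)"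
  unfolding bilinear_def by (auto intro: linear_compose[unfolded o_def, OF _ linear_extend])

lemma extend_sphere_laplacian:
  "extend (sphere_laplacian G x) y = (\<Sum>b\<in>Basis. extend (sphere_hess G x b b) y) - extend (sphere_hess G x x x) y"
  by (simp add: sphere_laplacian_def extend_diff linear_sum[OF linear_extend])

section \<open>Tension and bitension field of a map between spheres\<close>

locale sphere_map =
  fixes F f :: "'a::euclidean_space \<Rightarrow> 'b::euclidean_space"
  assumes smooth_F: "Cinf F"
    and maps_sphere: "F ` unit_sphere \<subseteq> unit_sphere"
    and restriction: "x \<in> unit_sphere \<Longrightarrow> f x = F x"
begin

lemma smooth_f: "smooth_on_sphere f"
  by (rule smooth_on_sphere_Cinf[OF smooth_F restriction])

lemma f_maps_sphere: "f ` unit_sphere \<subseteq> unit_sphere"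
  using maps_sphere restriction by auto

lemma F_inner_F: "x \<in> unit_sphere \<Longrightarrow> F x \<bullet> F x = 1"
  using maps_sphere by (force simp: norm_eq_1)

lemma sphere_d_f: "x \<in> unit_sphere \<Longrightarrow> v \<in> tangent_space x \<Longrightarrow> sphere_d f x v = partial v F x"
  by (rule sphere_d_Cinf[OF smooth_F restriction])

lemma partial_F_tangent: "x \<in> unit_sphere \<Longrightarrow> v \<in> tangent_space x \<Longrightarrow> F x \<bullet> partial v F x = 0"
  using sphere_d_tangent[OF smooth_f f_maps_sphere, of x v] sphere_d_f[of x v] restriction[of x]
  by (simp add: tangent_space_def)

lemma pullback_connection_Cinf:
  assumes G: "Cinf G" and s: "\<And>y. y \<in> unit_sphere \<Longrightarrow> \<sigma> y = G y"
    and t: "\<And>y. y \<in> unit_sphere \<Longrightarrow> F y \<bullet> G y = 0"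
    and x: "x \<in> unit_sphere" and v: "v \<in> tangent_space x"
  shows "pullback_connection f \<sigma> x v = extend (partial v G x) (F x)"
proof -
  have "section_along f \<sigma>"
    using smooth_on_sphere_Cinf[OF G s] s t restriction by (simp add: section_along_def tangent_space_def)
  from pullback_connection_eq_tproj[OF smooth_f f_maps_sphere this x v]
  show ?thesis using restriction[OF x] sphere_d_Cinf[OF G s x v] by (simp add: tproj_def)
qed

lemma second_fundamental_form_eq:
  assumes x: "x \<in> unit_sphere" and v: "v \<in> tangent_space x" and w: "w \<in> tangent_space x"
  shows "second_fundamental_form f x v w = extend (sphere_hess F x v w) (F x)"
proof -
  have "pullback_connection f (\<lambda>y. sphere_d f y (extend w y)) x v
      = extend (partial v (\<lambda>y. partial (extend w y) F y) x) (F x)"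
    by (rule pullback_connection_Cinf[OF Cinf_partial_extend_direction[OF smooth_F] _ _ x v])
       (simp_all add: sphere_d_f partial_F_tangent extend_in_tangent)
  moreover have "levi_civita (extend w) x v = 0"
    using levi_civita_extend[OF x v] w by (simp add: tangent_space_def)
  moreover have "sphere_d f x 0 = 0"
    using sphere_d_f[OF x zero_in_tangent_space] linear_0[OF linear_partial[OF smooth_F]] by simp
  ultimately show ?thesis
    by (simp add: second_fundamental_form_def partial_partial_extend[OF smooth_F w])
qed

lemma tension_field_projection:
  assumes x: "x \<in> unit_sphere"
  shows "tension_field f x = extend (sphere_laplacian F x) (F x)"
  unfolding tension_field_def extend_sphere_laplacian
  by (rule metric_trace_bilinear[OF x bilinear_extend[OF bilinear_sphere_hess[OF smooth_F]]])
     (rule second_fundamental_form_eq[OF x])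

text \<open>Apply the Laplacian of the sphere to \<open>F \<bullet> F = 1\<close>.\<close>

lemma F_inner_laplacian:
  assumes x: "x \<in> unit_sphere"
  shows "F x \<bullet> sphere_laplacian F x = - sphere_d_inner_d F F x"
  using sphere_laplacian_of_constant[OF Cinf_inner[OF smooth_F smooth_F] F_inner_F x]
    sphere_laplacian_inner[OF smooth_F smooth_F, of x]
  by (simp add: inner_commute)

lemma tension_field_eq:
  assumes x: "x \<in> unit_sphere"
  shows "tension_field f x = sphere_laplacian F x + sphere_d_inner_d F F x *\<^sub>R F x"
  using F_inner_laplacian[OF x] by (simp add: tension_field_projection[OF x] extend_def)

lemma tension_field_normal: "x \<in> unit_sphere \<Longrightarrow> F x \<bullet> tension_field f x = 0"
  using extend_in_tangent[of "F x"] maps_sphere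
  by (force simp: tension_field_projection tangent_space_def)

text \<open>Let \<open>T\<close> extend the tension field. The second covariant derivative is the tangential part of the
  Hessian of \<open>T\<close> plus the term \<open>(partial w F \<bullet> T) partial v F\<close>, which arises from differentiating
  the normal projection. The trace of this term is cancelled by one of the two curvature
  terms; the other one is the last summand of the result. The normal part of the Laplacian of \<open>T\<close> is
  obtained by applying the Laplacian to \<open>F \<bullet> T = 0\<close>.\<close>

lemma bitension_field_eq:
  assumes T: "Cinf T" and tau: "\<And>y. y \<in> unit_sphere \<Longrightarrow> tension_field f y = T y"
    and x: "x \<in> unit_sphere"
  shows "bitension_field f x = sphere_laplacian T x
    + (T x \<bullet> T x + 2 * sphere_d_inner_d F T x) *\<^sub>R F x + sphere_d_inner_d F F x *\<^sub>R T x"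
proof -
  have TF: "F y \<bullet> T y = 0" if "y \<in> unit_sphere" for y
    using tension_field_normal[OF that] tau[OF that] by simp
  \<comment> \<open>The normal part of the derivative of a section is determined by the section itself.\<close>
  have FdT: "F y \<bullet> partial v T y = - (partial v F y \<bullet> T y)"
    if "y \<in> unit_sphere" "v \<in> tangent_space y" for y v
    using partial_tangent_zero[OF Cinf_inner[OF smooth_F T] TF that]
    by (simp add: partial_inner smooth_F T)
  have cov: "pullback_connection f (tension_field f) y v = extend (partial v T y) (F y)"
    if "y \<in> unit_sphere" "v \<in> tangent_space y" for y v
    by (rule pullback_connection_Cinf[OF T tau TF that])
  note bl = bilinear_extend[OF bilinear_sphere_hess[OF T], of x "F x"]
  note lF = linear_partial[OF smooth_F, of x]
  have second: "second_covariant_derivative f (tension_field f) x v w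
      = extend (sphere_hess T x v w) (F x) + (partial w F x \<bullet> T x) *\<^sub>R partial v F x"
    if v: "v \<in> tangent_space x" and w: "w \<in> tangent_space x" for v w
  proof -
    \<comment> \<open>\<open>G\<close> extends the covariant derivative of the tension field along \<open>extend w\<close>.\<close>
    define U where "U y = partial (extend w y) T y" for y
    define G where "G y = U y - (F y \<bullet> U y) *\<^sub>R F y" for y
    have G_extend: "G y = extend (partial (extend w y) T y) (F y)" for y
      by (simp add: G_def U_def extend_def)
    have U: "Cinf U" unfolding U_def[abs_def] by (rule Cinf_partial_extend_direction[OF T])
    have G: "Cinf G" unfolding G_def[abs_def] by (intro Cinf_intros U smooth_F)
    have "pullback_connection f (\<lambda>y. pullback_connection f (tension_field f) y (extend w y)) x v
        = extend (partial v G x) (F x)"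
      by (rule pullback_connection_Cinf[OF G _ _ x v])
         (simp_all add: cov extend_in_tangent G_extend, simp add: extend_def F_inner_F inner_diff_right)
    also have "partial v G x = sphere_hess T x v w
        - (F x \<bullet> partial v U x + partial v F x \<bullet> U x) *\<^sub>R F x - (F x \<bullet> U x) *\<^sub>R partial v F x"
      using partial_partial_extend[OF T w, of v]
      by (simp add: G_def[abs_def] partial_diff partial_scaleR partial_inner Cinf_intros U smooth_F
          U_def[symmetric] algebra_simps)
    also have "extend \<dots> (F x) = extend (sphere_hess T x v w) (F x) - (F x \<bullet> U x) *\<^sub>R partial v F x"
    proof -
      have "extend (F x) (F x) = 0" by (simp add: extend_def F_inner_F[OF x])
      moreover have "extend (partial v F x) (F x) = partial v F x"
        by (simp add: extend_def partial_F_tangent[OF x v])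
      ultimately show ?thesis by (simp only: extend_diff extend_scaleR) simp
    qed
    also have "F x \<bullet> U x = - (partial w F x \<bullet> T x)"
      using FdT[OF x w] by (simp add: U_def extend_tangent[OF w])
    finally have 1: "pullback_connection f (\<lambda>y. pullback_connection f (tension_field f) y (extend w y)) x v
        = extend (sphere_hess T x v w) (F x) + (partial w F x \<bullet> T x) *\<^sub>R partial v F x" by simp
    have "levi_civita (extend w) x v = 0"
      using levi_civita_extend[OF x v] w by (simp add: tangent_space_def)
    moreover have "pullback_connection f (tension_field f) x 0 = 0"
      unfolding cov[OF x zero_in_tangent_space] by (simp add: linear_0[OF linear_partial[OF T]] extend_def)
    ultimately show ?thesis by (simp add: second_covariant_derivative_def 1)
  qed
  have "- rough_laplacian f (tension_field f) x
    = (\<Sum>b\<in>Basis. extend (sphere_hess T x b b) (F x) + (partial b F x \<bullet> T x) *\<^sub>R partial b F x)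
      - (extend (sphere_hess T x x x) (F x) + (partial x F x \<bullet> T x) *\<^sub>R partial x F x)"
    unfolding rough_laplacian_def minus_minus
  proof (rule metric_trace_bilinear[OF x, where B =
        "\<lambda>v w. extend (sphere_hess T x v w) (F x) + (partial w F x \<bullet> T x) *\<^sub>R partial v F x"])
    have "bilinear (\<lambda>v w. (partial w F x \<bullet> T x) *\<^sub>R partial v F x)"
      by (simp add: bilinear_def linear_iff linear_add[OF lF] linear_scale[OF lF] inner_add algebra_simps)
    with bl show "bilinear (\<lambda>v w. extend (sphere_hess T x v w) (F x) + (partial w F x \<bullet> T x) *\<^sub>R partial v F x)"
      by (simp add: bilinear_def linear_compose_add)
  qed (rule second)
  also have "\<dots> = extend (sphere_laplacian T x) (F x)
      + ((\<Sum>b\<in>Basis. (partial b F x \<bullet> T x) *\<^sub>R partial b F x) - (euler F x \<bullet> T x) *\<^sub>R euler F x)"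
    by (simp add: extend_sphere_laplacian sum.distrib euler_def)
  finally have rough: "- rough_laplacian f (tension_field f) x = \<dots>" .
  have "metric_trace x (\<lambda>v w. curvature (f x) (sphere_d f x v) (tension_field f x) (sphere_d f x w))
    = (\<Sum>b\<in>Basis. (partial b F x \<bullet> T x) *\<^sub>R partial b F x - (partial b F x \<bullet> partial b F x) *\<^sub>R T x)
      - ((partial x F x \<bullet> T x) *\<^sub>R partial x F x - (partial x F x \<bullet> partial x F x) *\<^sub>R T x)"
  proof (rule metric_trace_bilinear[OF x, where B =
        "\<lambda>v w. (partial w F x \<bullet> T x) *\<^sub>R partial v F x - (partial v F x \<bullet> partial w F x) *\<^sub>R T x"])
    show "bilinear (\<lambda>v w. (partial w F x \<bullet> T x) *\<^sub>R partial v F x - (partial v F x \<bullet> partial w F x) *\<^sub>R T x)"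
      by (simp add: bilinear_def linear_iff linear_add[OF lF] linear_scale[OF lF]
          inner_add algebra_simps)
  next
    fix e assume e: "e \<in> tangent_space x"
    have "F x \<in> unit_sphere" using maps_sphere x by blast
    then show "curvature (f x) (sphere_d f x e) (tension_field f x) (sphere_d f x e)
      = (partial e F x \<bullet> T x) *\<^sub>R partial e F x - (partial e F x \<bullet> partial e F x) *\<^sub>R T x"
      using curvature_unit_sphere[of "F x" "partial e F x" "T x" "partial e F x"] TF[OF x]
      by (simp add: sphere_d_f[OF x e] restriction[OF x] tau[OF x] tangent_space_def
          partial_F_tangent[OF x e] inner_commute)
  qed
  also have "\<dots> = (\<Sum>b\<in>Basis. (partial b F x \<bullet> T x) *\<^sub>R partial b F x) - (euler F x \<bullet> T x) *\<^sub>R euler F x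
      - sphere_d_inner_d F F x *\<^sub>R T x"
    by (simp add: sphere_d_inner_d_def euler_def sum_subtractf scaleR_sum_left algebra_simps)
  finally have "bitension_field f x = extend (sphere_laplacian T x) (F x) + sphere_d_inner_d F F x *\<^sub>R T x"
    by (simp add: bitension_field_def rough)
  moreover have "F x \<bullet> sphere_laplacian T x = - (T x \<bullet> T x + 2 * sphere_d_inner_d F T x)"
  proof -
    have "F x \<bullet> sphere_laplacian T x + sphere_laplacian F x \<bullet> T x + 2 * sphere_d_inner_d F T x = 0"
      using sphere_laplacian_of_constant[OF Cinf_inner[OF smooth_F T] TF x]
        sphere_laplacian_inner[OF smooth_F T, of x] by simp
    moreover have "sphere_laplacian F x \<bullet> T x = T x \<bullet> T x"
      using tension_field_eq[OF x] tau[OF x] TF[OF x] by (metis add.right_neutral inner_add_left inner_scaleR_left mult_zero_right)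
    ultimately show ?thesis by simp
  qed
  ultimately show ?thesis by (simp add: extend_def algebra_simps)
qed

end

section \<open>The flat Laplacian and homogeneous maps\<close>

lemma flat_laplacian_fun: "flat_laplacian G = (\<lambda>x. - (\<Sum>b\<in>Basis. partial b (partial b G) x))"
  by (simp add: flat_laplacian_def fun_eq_iff)

lemma Cinf_flat_laplacian: "Cinf G \<Longrightarrow> Cinf (flat_laplacian G)"
  unfolding flat_laplacian_fun by (intro Cinf_intros)

lemma partial_flat_laplacian:
  fixes G :: "'a::euclidean_space \<Rightarrow> 'b::euclidean_space"
  assumes G: "Cinf G"
  shows "partial v (flat_laplacian G) = flat_laplacian (partial v G)"
proof -
  have "partial v (partial b (partial b G)) x = partial b (partial b (partial v G)) x" for b x
  proof -
    have "partial v (partial b G) = partial b (partial v G)"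
      using partial_commute[OF G] by fast
    moreover have "partial v (partial b (partial b G)) x = partial b (partial v (partial b G)) x"
      by (rule partial_commute[OF Cinf_partial[OF G]])
    ultimately show ?thesis by simp
  qed
  then show ?thesis
    unfolding flat_laplacian_fun by (simp add: partial_minus partial_sum Cinf_intros G)
qed

lemma flat_laplacian_bilinear:
  assumes B: "bounded_bilinear B" and f: "Cinf f" and g: "Cinf g"
  shows "flat_laplacian (\<lambda>y. B (f y) (g y)) x = B (f x) (flat_laplacian g x) + B (flat_laplacian f x) (g x)
    - 2 *\<^sub>R (\<Sum>b\<in>Basis. B (partial b f x) (partial b g x))"
proof -
  have "flat_laplacian (\<lambda>y. B (f y) (g y)) x = - (\<Sum>b\<in>Basis. B (f x) (partial b (partial b g) x)
      + B (partial b (partial b f) x) (g x) + 2 *\<^sub>R B (partial b f x) (partial b g x))"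
    unfolding flat_laplacian_def
    by (simp add: partial_bilinear[OF B] partial_add Cinf_bilinear[OF B] Cinf_partial f g scaleR_2
        algebra_simps)
  then show ?thesis
    by (simp add: flat_laplacian_def sum.distrib scaleR_sum_right bounded_bilinear.sum_left[OF B]
        bounded_bilinear.sum_right[OF B] bounded_bilinear.minus_left[OF B]
        bounded_bilinear.minus_right[OF B])
qed

lemma flat_laplacian_diff: "Cinf f \<Longrightarrow> Cinf g \<Longrightarrow>
    flat_laplacian (\<lambda>y. f y - g y) x = flat_laplacian f x - flat_laplacian g x"
  by (simp add: flat_laplacian_def partial_diff Cinf_partial sum_subtractf)

lemma flat_laplacian_sum: "(\<And>i. i \<in> I \<Longrightarrow> Cinf (h i)) \<Longrightarrow>
    flat_laplacian (\<lambda>y. \<Sum>i\<in>I. h i y) x = (\<Sum>i\<in>I. flat_laplacian (h i) x)"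
  unfolding flat_laplacian_def by (simp add: partial_sum Cinf_partial sum_negf) (rule sum.swap)

text \<open>Homogeneity in the form of Euler's identity, which can be differentiated directly. The degree is a real number so that \<open>r - 1\<close> and \<open>r - 2\<close> are meaningful for every degree; for a constant
  map, say, the derivatives are zero and satisfy the identity with a negative degree.\<close>

definition homogeneous :: "real \<Rightarrow> ('a::euclidean_space \<Rightarrow> 'b::real_normed_vector) \<Rightarrow> bool" where
  "homogeneous r G \<longleftrightarrow> (\<forall>x. euler G x = r *\<^sub>R G x)"

lemma homogeneous_partial:
  fixes G :: "'a::euclidean_space \<Rightarrow> 'b::euclidean_space"
  assumes G: "Cinf G" and h: "homogeneous r G"
  shows "homogeneous (r - 1) (partial v G)"
  unfolding homogeneous_def
proof
  fix x
  have "euler (partial v G) x = partial v (partial x G) x"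
    by (simp add: euler_def partial_commute[OF G])
  also have "\<dots> = partial v (euler G) x - partial v G x" by (simp add: partial_euler[OF G])
  also have "euler G = (\<lambda>x. r *\<^sub>R G x)" using h by (auto simp: homogeneous_def)
  finally show "euler (partial v G) x = (r - 1) *\<^sub>R partial v G x"
    by (simp add: partial_scaleR_const G algebra_simps)
qed

lemma homogeneous_bilinear:
  assumes B: "bounded_bilinear B" and "Cinf f" "Cinf g" "homogeneous r f" "homogeneous s g"
  shows "homogeneous (r + s) (\<lambda>x. B (f x) (g x))"
  using assms by (simp add: homogeneous_def euler_def partial_bilinear[OF B]
      bounded_bilinear.scaleR_left[OF B] bounded_bilinear.scaleR_right[OF B] algebra_simps)

lemma homogeneous_sum:
  assumes "\<And>i. i \<in> I \<Longrightarrow> Cinf (h i)" "\<And>i. i \<in> I \<Longrightarrow> homogeneous r (h i)"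
  shows "homogeneous r (\<lambda>x. \<Sum>i\<in>I. h i x)"
  using assms by (simp add: homogeneous_def euler_def partial_sum scaleR_sum_right)

lemma homogeneous_flat_laplacian:
  fixes G :: "'a::euclidean_space \<Rightarrow> 'b::euclidean_space"
  assumes G: "Cinf G" and h: "homogeneous r G"
  shows "homogeneous (r - 2) (flat_laplacian G)"
proof -
  have "homogeneous (r - 1 - 1) (\<lambda>x. \<Sum>b\<in>Basis. partial b (partial b G) x)"
    by (intro homogeneous_sum homogeneous_partial Cinf_partial G h)
  then show ?thesis
    unfolding flat_laplacian_fun
    by (simp add: homogeneous_def euler_def partial_minus Cinf_intros G algebra_simps)
qed

definition sqnorm_d :: "('a::euclidean_space \<Rightarrow> 'b::euclidean_space) \<Rightarrow> 'a \<Rightarrow> real" where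
  "sqnorm_d G x = (\<Sum>b\<in>Basis. partial b G x \<bullet> partial b G x)"

lemma sqnorm_d_fun: "sqnorm_d G = (\<lambda>x. \<Sum>b\<in>Basis. partial b G x \<bullet> partial b G x)"
  by (simp add: sqnorm_d_def fun_eq_iff)

lemma Cinf_sqnorm_d: "Cinf G \<Longrightarrow> Cinf (sqnorm_d G)"
  unfolding sqnorm_d_fun by (intro Cinf_intros)

lemma homogeneous_sqnorm_d:
  assumes G: "Cinf G" and h: "homogeneous r G"
  shows "homogeneous (2 * r - 2) (sqnorm_d G)"
proof -
  have "homogeneous ((r - 1) + (r - 1)) (sqnorm_d G)"
    unfolding sqnorm_d_fun
    by (intro homogeneous_sum homogeneous_bilinear[OF bounded_bilinear_inner] homogeneous_partial
        Cinf_intros G h)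
  then show ?thesis by (simp add: algebra_simps)
qed

text \<open>A Bochner formula: in flat space the Laplacian commutes with the differential, so no curvature
  term appears. It accounts for the terms with \<open>norm_dd\<close> and with the Laplacian of the energy density in
  the bitension field.\<close>

lemma flat_laplacian_sqnorm_d:
  assumes G: "Cinf G"
  shows "flat_laplacian (sqnorm_d G) x =
    2 * (\<Sum>b\<in>Basis. partial b G x \<bullet> partial b (flat_laplacian G) x) - 2 * (norm_dd G x)\<^sup>2"
proof -
  have n: "(norm_dd G x)\<^sup>2 = (\<Sum>b\<in>Basis. \<Sum>c\<in>Basis. partial b (partial c G) x \<bullet> partial b (partial c G) x)"
    unfolding norm_dd_def by (simp add: sum_nonneg power2_norm_eq_inner)
  have "flat_laplacian (sqnorm_d G) x = (\<Sum>c\<in>Basis. 2 * (partial c G x \<bullet> partial c (flat_laplacian G) x)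
      - 2 * (\<Sum>b\<in>Basis. partial b (partial c G) x \<bullet> partial b (partial c G) x))"
    unfolding sqnorm_d_fun
    by (simp add: flat_laplacian_sum Cinf_intros G flat_laplacian_bilinear[OF bounded_bilinear_inner]
        partial_flat_laplacian inner_commute)
  also have "\<dots> = 2 * (\<Sum>b\<in>Basis. partial b G x \<bullet> partial b (flat_laplacian G) x)
      - 2 * (\<Sum>c\<in>Basis. \<Sum>b\<in>Basis. partial b (partial c G) x \<bullet> partial b (partial c G) x)"
    by (simp add: sum_subtractf sum_distrib_left)
  also have "(\<Sum>c\<in>Basis. \<Sum>b\<in>Basis. partial b (partial c G) x \<bullet> partial b (partial c G) x) = (norm_dd G x)\<^sup>2"
    unfolding n by (rule sum.swap)
  finally show ?thesis .
qed

lemma norm_d_power2: "(norm_d G x)\<^sup>2 = sqnorm_d G x"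
  unfolding norm_d_def sqnorm_d_def by (simp add: sum_nonneg power2_norm_eq_inner)

section \<open>The bitension field of a homogeneous map\<close>

locale homogeneous_sphere_map = sphere_map F f
  for F f :: "'a::euclidean_space \<Rightarrow> 'b::euclidean_space" +
  fixes k m :: real
  assumes homogeneous_F: "homogeneous k F"
    and dim: "real DIM('a) = m + 1"
begin

text \<open>The formula for the tension field on the sphere, read as a map on the ambient space. In
  general it is not homogeneous, but each of its three terms is, with degrees \<open>k - 2\<close>, \<open>3 k - 2\<close> and \<open>k\<close>.\<close>

definition tension_extension :: "'a \<Rightarrow> 'b" where
  "tension_extension y = (sqnorm_d F y - k * (2 * k + m - 1)) *\<^sub>R F y - flat_laplacian F y"

lemma euler_F: "euler F = (\<lambda>y. k *\<^sub>R F y)"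
  using homogeneous_F by (auto simp: homogeneous_def)

lemma euler_laplacian: "euler (flat_laplacian F) = (\<lambda>y. (k - 2) *\<^sub>R flat_laplacian F y)"
  using homogeneous_flat_laplacian[OF smooth_F homogeneous_F] by (auto simp: homogeneous_def)

lemma euler_sqnorm_d: "euler (sqnorm_d F) = (\<lambda>y. (2 * k - 2) * sqnorm_d F y)"
  using homogeneous_sqnorm_d[OF smooth_F homogeneous_F] by (auto simp: homogeneous_def)

lemmas partial_self = euler_F[unfolded euler_def fun_eq_iff, rule_format]
  euler_laplacian[unfolded euler_def fun_eq_iff, rule_format]
  euler_sqnorm_d[unfolded euler_def fun_eq_iff, rule_format]

lemma euler_euler_F: "euler (euler F) x = (k * k) *\<^sub>R F x"
  unfolding euler_F by (simp add: euler_def partial_scaleR_const smooth_F partial_self)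

lemmas smooth_intros = Cinf_intros smooth_F Cinf_flat_laplacian[OF smooth_F] Cinf_sqnorm_d[OF smooth_F]

lemma tension_extension_fun: "tension_extension =
    (\<lambda>y. (sqnorm_d F y - k * (2 * k + m - 1)) *\<^sub>R F y - flat_laplacian F y)"
  by (simp add: tension_extension_def fun_eq_iff)

lemma Cinf_tension_extension: "Cinf tension_extension"
  unfolding tension_extension_fun by (intro smooth_intros)

lemma tension_field_extension:
  assumes x: "x \<in> unit_sphere"
  shows "tension_field f x = tension_extension x"
proof -
  have FF: "sphere_d_inner_d F F x = sqnorm_d F x - k\<^sup>2"
    using F_inner_F[OF x] by (simp add: sphere_d_inner_d_def sqnorm_d_def euler_F power2_eq_square)
  show ?thesis
    unfolding FF tension_field_eq[OF x] sphere_laplacian_eq[OF smooth_F x] tension_extension_def euler_euler_F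
    by (rule euclidean_eqI) (simp add: euler_F dim algebra_simps power2_eq_square)
qed

text \<open>Tangential derivatives of \<open>F\<close> are orthogonal to \<open>F\<close>, and the normal derivative is \<open>k F\<close>.\<close>

lemma F_inner_partial:
  assumes x: "x \<in> unit_sphere"
  shows "F x \<bullet> partial v F x = k * (x \<bullet> v)"
proof -
  have "F x \<bullet> partial (extend v x) F x = 0"
    by (rule partial_F_tangent[OF x extend_in_tangent[OF x]])
  then show ?thesis
    using fun_cong[OF partial_extend_direction[OF smooth_F, of v], of x] F_inner_F[OF x]
    by (simp add: inner_diff_right euler_F)
qed

text \<open>This expresses that the tension field is tangent to the target sphere.\<close>

lemma F_inner_flat_laplacian:
  assumes x: "x \<in> unit_sphere"
  shows "F x \<bullet> flat_laplacian F x = sqnorm_d F x - k * (2 * k + m - 1)"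
  using tension_field_normal[OF x] F_inner_F[OF x]
  by (simp add: tension_field_extension[OF x] tension_extension_def inner_diff_right)

lemma partial_tension_extension: "partial v tension_extension = (\<lambda>x.
    (sqnorm_d F x - k * (2 * k + m - 1)) *\<^sub>R partial v F x + partial v (sqnorm_d F) x *\<^sub>R F x
    - partial v (flat_laplacian F) x)"
  unfolding tension_extension_fun
  by (simp add: partial_scaleR partial_diff partial_const smooth_intros)

lemma euler_tension_extension: "euler tension_extension = (\<lambda>x.
    ((3 * k - 2) * sqnorm_d F x - k\<^sup>2 * (2 * k + m - 1)) *\<^sub>R F x - (k - 2) *\<^sub>R flat_laplacian F x)"
  by (rule ext, rule euclidean_eqI)
    (simp add: euler_def partial_tension_extension partial_self algebra_simps power2_eq_square)

lemma euler_euler_tension_extension: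
  "euler (euler tension_extension) x =
    ((3 * k - 2)\<^sup>2 * sqnorm_d F x - k ^ 3 * (2 * k + m - 1)) *\<^sub>R F x - (k - 2)\<^sup>2 *\<^sub>R flat_laplacian F x"
  unfolding euler_tension_extension
  by (rule euclidean_eqI, simp add: euler_def partial_scaleR partial_diff partial_const smooth_intros
      partial_self partial_bilinear[OF bounded_bilinear_mult] inner_add_left inner_diff_left)
    (simp add: algebra_simps power2_eq_square power3_eq_cube)

lemma flat_laplacian_tension_extension:
  "flat_laplacian tension_extension x = - flat_laplacian (flat_laplacian F) x
    + (sqnorm_d F x - k * (2 * k + m - 1)) *\<^sub>R flat_laplacian F x
    + flat_laplacian (sqnorm_d F) x *\<^sub>R F x
    - 2 *\<^sub>R (\<Sum>b\<in>Basis. partial b (sqnorm_d F) x *\<^sub>R partial b F x)"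
proof -
  have "flat_laplacian (\<lambda>y. sqnorm_d F y - c) x = flat_laplacian (sqnorm_d F) x"
    and "partial b (\<lambda>y. sqnorm_d F y - c) x = partial b (sqnorm_d F) x" for b c
    by (simp_all add: flat_laplacian_def partial_diff partial_const smooth_intros)
  then show ?thesis
    unfolding tension_extension_fun
    by (simp add: flat_laplacian_diff[of _ "flat_laplacian F"] smooth_intros
        flat_laplacian_bilinear[OF bounded_bilinear_scaleR])
qed

lemma tension_inner_tension:
  assumes x: "x \<in> unit_sphere"
  shows "tension_extension x \<bullet> tension_extension x =
    (norm (flat_laplacian F x))\<^sup>2 - (sqnorm_d F x - k * (2 * k + m - 1))\<^sup>2"
proof -
  have sq: "(c *\<^sub>R p - a) \<bullet> (c *\<^sub>R p - a) = c\<^sup>2 * (p \<bullet> p) - 2 * c * (p \<bullet> a) + a \<bullet> a" for c and p a :: 'b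
    by (simp add: inner_diff inner_commute algebra_simps power2_eq_square)
  show ?thesis
    unfolding tension_extension_def sq power2_norm_eq_inner F_inner_flat_laplacian[OF x] F_inner_F[OF x]
    by (simp add: power2_eq_square)
qed

text \<open>The product of the differentials of \<open>F\<close> and of its Laplacian comes from the Bochner formula. In
  the term with the gradient of the energy density only the normal direction survives, since \<open>F\<close> is
  orthogonal to its tangential derivatives; there Euler's identity applies.\<close>

lemma d_inner_d_tension:
  assumes x: "x \<in> unit_sphere"
  shows "2 * sphere_d_inner_d F tension_extension x = - flat_laplacian (sqnorm_d F) x - 2 * (norm_dd F x)\<^sup>2
    + 2 * (sqnorm_d F x - k * (2 * k + m - 1)) * sqnorm_d F x + 2 * k * (2 * k - 2) * sqnorm_d F x
    - 2 * k * (2 * k * sqnorm_d F x - 2 * k * (2 * k + m - 1))"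
proof -
  have q: "(\<Sum>b\<in>Basis. partial b (sqnorm_d F) x * (x \<bullet> b)) = (2 * k - 2) * sqnorm_d F x"
    using fun_cong[OF euler_Basis[OF Cinf_sqnorm_d[OF smooth_F]], of x]
    by (simp add: euler_sqnorm_d mult.commute)
  have "partial b F x \<bullet> partial b tension_extension x
    = (sqnorm_d F x - k * (2 * k + m - 1)) * (partial b F x \<bullet> partial b F x)
      + k * (partial b (sqnorm_d F) x * (x \<bullet> b)) - partial b F x \<bullet> partial b (flat_laplacian F) x" for b
    unfolding partial_tension_extension inner_diff_right inner_add_right inner_scaleR_right
      inner_commute[of "partial b F x" "F x"] F_inner_partial[OF x] by simp
  then have "(\<Sum>b\<in>Basis. partial b F x \<bullet> partial b tension_extension x)
    = (sqnorm_d F x - k * (2 * k + m - 1)) * (\<Sum>b\<in>Basis. partial b F x \<bullet> partial b F x)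
      + k * (\<Sum>b\<in>Basis. partial b (sqnorm_d F) x * (x \<bullet> b))
      - (\<Sum>b\<in>Basis. partial b F x \<bullet> partial b (flat_laplacian F) x)"
    by (simp only: sum.distrib sum_subtractf sum_distrib_left)
  also have "\<dots> = - (\<Sum>b\<in>Basis. partial b F x \<bullet> partial b (flat_laplacian F) x)
      + (sqnorm_d F x - k * (2 * k + m - 1)) * sqnorm_d F x + k * ((2 * k - 2) * sqnorm_d F x)"
    by (simp add: q sqnorm_d_def[symmetric])
  finally have 1: "(\<Sum>b\<in>Basis. partial b F x \<bullet> partial b tension_extension x) = \<dots>" .
  have 2: "euler F x \<bullet> euler tension_extension x
      = k * (2 * k * sqnorm_d F x - 2 * k * (2 * k + m - 1))"
    unfolding euler_F euler_tension_extension inner_diff_right inner_scaleR_right inner_scaleR_left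
      F_inner_F[OF x] F_inner_flat_laplacian[OF x]
    by (simp add: algebra_simps power2_eq_square)
  show ?thesis
    unfolding sphere_d_inner_d_def 1 2 flat_laplacian_sqnorm_d[OF smooth_F]
    by (simp add: algebra_simps)
qed

theorem bitension_field_homogeneous:
  assumes x: "x \<in> unit_sphere"
  shows "bitension_field f x =
      flat_laplacian (flat_laplacian F) x
      + (2 * (m * k + 2 * k\<^sup>2 - 3 * k - m + 3 - sqnorm_d F x)) *\<^sub>R flat_laplacian F x
      + (- 2 * flat_laplacian (sqnorm_d F) x
         - 2 * (norm_dd F x)\<^sup>2
         + (norm (flat_laplacian F x))\<^sup>2
         - 2 * (2 * m * k + 6 * k\<^sup>2 - 6 * k - m + 3) * sqnorm_d F x
         + 2 * (sqnorm_d F x)\<^sup>2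
         + 4 * k\<^sup>2 * (m + 2 * k - 1)) *\<^sub>R F x
      + 2 *\<^sub>R (\<Sum>b\<in>Basis. partial b (sqnorm_d F) x *\<^sub>R partial b F x)"
proof -
  have FF: "sphere_d_inner_d F F x = sqnorm_d F x - k\<^sup>2"
    using F_inner_F[OF x] by (simp add: sphere_d_inner_d_def sqnorm_d_def euler_F power2_eq_square)
  have d: "real DIM('a) - 2 = m - 1" using dim by simp
  have bi: "bitension_field f x = sphere_laplacian tension_extension x
    + (tension_extension x \<bullet> tension_extension x + 2 * sphere_d_inner_d F tension_extension x) *\<^sub>R F x
    + sphere_d_inner_d F F x *\<^sub>R tension_extension x"
    by (rule bitension_field_eq[OF Cinf_tension_extension tension_field_extension x])
  show ?thesis
    unfolding bi
      sphere_laplacian_eq[OF Cinf_tension_extension x] FF d tension_inner_tension[OF x] d_inner_d_tension[OF x]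
      euler_euler_tension_extension flat_laplacian_tension_extension
    unfolding euler_tension_extension tension_extension_def
    by (rule euclidean_eqI)
      (simp add: inner_add_left inner_diff_left algebra_simps power2_eq_square power3_eq_cube)
qed

end

section \<open>Forms are smooth and homogeneous\<close>

lemma Cinf_prod:
  fixes h :: "'i \<Rightarrow> 'a::euclidean_space \<Rightarrow> real"
  assumes "\<And>i. i \<in> I \<Longrightarrow> Cinf (h i)"
  shows "Cinf (\<lambda>x. \<Prod>i\<in>I. h i x)"
  using assms by (induction I rule: infinite_finite_induct) (simp_all add: Cinf_const Cinf_mult)

lemma Cinf_power:
  fixes h :: "'a::euclidean_space \<Rightarrow> real"
  shows "Cinf h \<Longrightarrow> Cinf (\<lambda>x. h x ^ j)"
  by (induction j) (simp_all add: Cinf_const Cinf_mult)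

lemma Cinf_form:
  fixes F :: "real^'p \<Rightarrow> real^'q"
  assumes "form k F"
  shows "Cinf F"
proof -
  obtain c where c: "\<And>x j. F x $ j = (\<Sum>\<alpha> | (\<Sum>i\<in>UNIV. \<alpha> i) = k. c j \<alpha> * (\<Prod>i\<in>UNIV. x $ i ^ \<alpha> i))"
    using assms unfolding form_def by blast
  have "F x = (\<Sum>j\<in>UNIV. (F x $ j) *\<^sub>R axis j 1)" for x
    by (simp add: vec_eq_iff axis_def if_distrib cong: if_cong)
  moreover have "Cinf (\<lambda>x. F x $ j)" for j
  proof -
    have "Cinf (\<lambda>x. (x::real^'p) $ i)" for i
      using Cinf_inner[OF Cinf_id Cinf_const[of "axis i 1 :: real^'p"]] by (simp add: inner_axis inner_real_def)
    then show ?thesis unfolding c by (intro Cinf_intros Cinf_prod Cinf_power)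
  qed
  then have "Cinf (\<lambda>x. \<Sum>j\<in>UNIV. (F x $ j) *\<^sub>R (axis j 1 :: real^'q))" by (intro Cinf_intros)
  ultimately show ?thesis by simp
qed

lemma form_scaleR:
  assumes "form k F"
  shows "F (t *\<^sub>R x) = t ^ k *\<^sub>R F x"
proof -
  obtain c where c: "\<And>x j. F x $ j = (\<Sum>\<alpha> | (\<Sum>i\<in>UNIV. \<alpha> i) = k. c j \<alpha> * (\<Prod>i\<in>UNIV. x $ i ^ \<alpha> i))"
    using assms unfolding form_def by blast
  show ?thesis
    unfolding vec_eq_iff
    by (auto simp: c power_mult_distrib prod.distrib sum_distrib_left power_sum[symmetric] intro!: sum.cong)
qed

text \<open>Differentiate \<open>F (t x) = t ^ k F x\<close> at \<open>t = 1\<close>.\<close>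

lemma homogeneous_form:
  fixes F :: "real^'p \<Rightarrow> real^'q"
  assumes F: "form k F"
  shows "homogeneous (real k) F"
  unfolding homogeneous_def
proof
  fix x :: "real^'p"
  have "((\<lambda>t. t *\<^sub>R x) has_derivative (\<lambda>h. h *\<^sub>R x)) (at 1)"
    by (auto intro!: derivative_eq_intros)
  from has_derivative_compose[OF this Cinf_has_derivative[OF Cinf_form[OF F]]]
  have "((\<lambda>t. F (t *\<^sub>R x)) has_derivative (\<lambda>h. partial (h *\<^sub>R x) F x)) (at 1)" by simp
  moreover have "((\<lambda>t. F (t *\<^sub>R x)) has_derivative (\<lambda>h. (h * real k) *\<^sub>R F x)) (at 1)"
    unfolding form_scaleR[OF F] by (auto intro!: derivative_eq_intros)
  ultimately show "euler F x = real k *\<^sub>R F x"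
    using has_derivative_unique by (fastforce simp: euler_def dest: fun_cong[of _ _ 1])
qed

theorem theorem3p1:
  fixes m n k :: nat
    and F :: "real^'p \<Rightarrow> real^'q"
    and \<phi> :: "real^'p \<Rightarrow> real^'q"
  assumes "CARD('p) = m + 1" and "CARD('q) = n + 1"
    and "form k F"
    and "F ` unit_sphere \<subseteq> unit_sphere"
    and "\<forall>x\<in>unit_sphere. \<phi> x = F x"
    and "\<not> \<phi> constant_on unit_sphere"
  shows "\<forall>x\<in>unit_sphere.
    bitension_field \<phi> x =
      flat_laplacian (flat_laplacian F) x
      + (2 * (real m * real k + 2 * (real k)\<^sup>2 - 3 * real k - real m + 3 - (norm_d F x)\<^sup>2))
          *\<^sub>R flat_laplacian F x
      + (- 2 * flat_laplacian (\<lambda>y. (norm_d F y)\<^sup>2) x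
         - 2 * (norm_dd F x)\<^sup>2
         + (norm (flat_laplacian F x))\<^sup>2
         - 2 * (2 * real m * real k + 6 * (real k)\<^sup>2 - 6 * real k - real m + 3) * (norm_d F x)\<^sup>2
         + 2 * (norm_d F x) ^ 4
         + 4 * (real k)\<^sup>2 * (real m + 2 * real k - 1)) *\<^sub>R \<phi> x
      + 2 *\<^sub>R frechet_derivative F (at x) (flat_grad (\<lambda>y. (norm_d F y)\<^sup>2) x)"
proof
  fix x :: "real^'p" assume x: "x \<in> unit_sphere"
  have smooth: "Cinf F" by (rule Cinf_form[OF assms(3)])
  interpret homogeneous_sphere_map F \<phi> "real k" "real m"
    using assms smooth homogeneous_form by unfold_locales auto
  have "norm_d F x ^ 4 = (sqnorm_d F x)\<^sup>2"
    by (simp add: norm_d_power2[symmetric])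
  moreover have "frechet_derivative F (at x) (flat_grad (sqnorm_d F) x)
      = (\<Sum>b\<in>Basis. partial b (sqnorm_d F) x *\<^sub>R partial b F x)"
    unfolding flat_grad_def partial_def[of _ F, symmetric]
    by (simp add: linear_sum[OF linear_partial[OF smooth]] linear_scale[OF linear_partial[OF smooth]])
  ultimately show "bitension_field \<phi> x =
      flat_laplacian (flat_laplacian F) x
      + (2 * (real m * real k + 2 * (real k)\<^sup>2 - 3 * real k - real m + 3 - (norm_d F x)\<^sup>2))
          *\<^sub>R flat_laplacian F x
      + (- 2 * flat_laplacian (\<lambda>y. (norm_d F y)\<^sup>2) x
         - 2 * (norm_dd F x)\<^sup>2
         + (norm (flat_laplacian F x))\<^sup>2
         - 2 * (2 * real m * real k + 6 * (real k)\<^sup>2 - 6 * real k - real m + 3) * (norm_d F x)\<^sup>2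
         + 2 * (norm_d F x) ^ 4
         + 4 * (real k)\<^sup>2 * (real m + 2 * real k - 1)) *\<^sub>R \<phi> x
      + 2 *\<^sub>R frechet_derivative F (at x) (flat_grad (\<lambda>y. (norm_d F y)\<^sup>2) x)"
    using bitension_field_homogeneous[OF x] restriction[OF x]
    by (simp add: norm_d_power2)
qed

end
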